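(* Let $r,e\geq2$ be integers. (i) If $x\in\mathbb{N}^{\mathcal{P}_e}$ then $q_e(x)\in\mathbb{N}$. (ii) We have $$N_{r,e}=\max_{\substack{x\in\mathbb{N}^{\mathcal{P}_e}\\ \|x\|_1=r}}q_e(x).$$
   Context: $\mathbb{N}=\{0,1,2,\dots\}$. $\mathcal{P}_e$ denotes the set of all subsets of $\{1,\dots,e\}$. For $E,F\in\mathcal{P}_e$ set $\mathsf{w}(E,F):=\min(|E|,|F|)-|E\cap F|$. The quadratic form $q_e$ on $\mathbb{R}^{\mathcal{P}_e}$ is $q_e(x):=\frac12\sum_{E,F\in\mathcal{P}_e}\mathsf{w}(E,F)\,x_Ex_F$, and $\|x\|_1:=\sum_{E\in\mathcal{P}_e}|x_E|$. Definition of $N_{r,e}$. A partition is a finite non-increasing sequence $\lambda = (\lambda_1\geq\dots\geq\lambda_h>0)$ of positive integers (possibly empty), with Young diagram $\{(a,b): 1\le a\le h,\ 1\le b\le \lambda_a\}$. An $r$-partition is an $r$-tuple $\boldsymbol\lambda=(\lambda^{(1)},\dots,\lambda^{(r)})$ of partitions; its nodes are the triples $(a,b,j)$ with $(a,b)$ in the Young diagram of $\lambda^{(j)}$. For a multicharge $\mathsf{s}=(s_1,\dots,s_r)\in\mathbb{Z}^r$, the $\mathsf{s}$-residue of $(a,b,j)$ is $b-a+s_j \bmod e$, and $c_i^{\mathsf{s}}(\boldsymbol\lambda)$ is the number of nodes of $\mathsf{s}$-residue $i\in\mathbb{Z}/e\mathbb{Z}$. The $\mathsf{s}$-weight is $\mathsf{w}^{\mathsf{s}}(\boldsymbol\lambda):=\sum_{j=1}^r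 c^{\mathsf{s}}_{s_j}(\boldsymbol\lambda)-\frac12\sum_{i\in\mathbb{Z}/e\mathbb{Z}}(c^{\mathsf{s}}_i(\boldsymbol\lambda)-c^{\mathsf{s}}_{i+1}(\boldsymbol\lambda))^2$ (indices modulo $e$). $Q=\bigoplus_{i\in\mathbb{Z}/e\mathbb{Z}}\mathbb{Z}\alpha_i$ is free abelian with basis $(\alpha_i)$; $\delta:=\sum_i\alpha_i$; $\alpha^{\mathsf{s}}(\boldsymbol\lambda):=\sum_i c_i^{\mathsf{s}}(\boldsymbol\lambda)\alpha_i$; $Q^{\mathsf{s}}:=\{\alpha^{\mathsf{s}}(\boldsymbol\lambda):\boldsymbol\lambda\text{ an }r\text{-partition}\}$. An $r$-partition $\boldsymbol\lambda$ is an $\mathsf{s}$-reduced $e$-multicore if $\alpha^{\mathsf{s}}(\boldsymbol\lambda)-\delta\notin Q^{\mathsf{s}}$. Then $$N_{r,e}:=\sup\{\mathsf{w}^{\mathsf{s}}(\boldsymbol\lambda):\mathsf{s}\in\mathbb{Z}^r,\ \boldsymbol\lambda\text{ an }\mathsf{s}\text{-reduced }e\text{-multicore}\},$$ which is known to be finite. *)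

theory Defs
  imports
    Complex_Main
    "HOL-Library.FuncSet"
    "HOL-Library.Extended_Real"
    "HOL-Library.Poly_Mapping"
begin

definition set_weight :: "nat set \<Rightarrow> nat set \<Rightarrow> int" where
  "set_weight E F = int (min (card E) (card F)) - int (card (E \<inter> F))"

text \<open>
  The space of real vectors indexed by the subsets of \<open>{1..e}\<close> is the set of extensional
  functions \<open>Pow {1..e} \<rightarrow>\<^sub>E UNIV\<close>; the vectors with entries in the natural numbers are the
  elements of \<open>Pow {1..e} \<rightarrow>\<^sub>E \<nat>\<close>.
\<close>

definition quad_form :: "nat \<Rightarrow> (nat set \<Rightarrow> real) \<Rightarrow> real" where
  "quad_form e x =
     (1/2) * (\<Sum>E\<in>Pow {1..e}. \<Sum>F\<in>Pow {1..e}. of_int (set_weight E F) * x E * x F)"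

definition norm_one :: "nat \<Rightarrow> (nat set \<Rightarrow> real) \<Rightarrow> real" where
  "norm_one e x = (\<Sum>E\<in>Pow {1..e}. \<bar>x E\<bar>)"

definition nat_vectors :: "nat \<Rightarrow> (nat set \<Rightarrow> real) set" where
  "nat_vectors e = (Pow {1..e} \<rightarrow>\<^sub>E \<nat>)"

definition is_partition :: "nat list \<Rightarrow> bool" where
  "is_partition p \<longleftrightarrow> sorted_wrt (\<ge>) p \<and> (\<forall>n\<in>set p. n > 0)"

definition young_diagram :: "nat list \<Rightarrow> (nat \<times> nat) set" where
  "young_diagram p = {(a, b). 1 \<le> a \<and> a \<le> length p \<and> 1 \<le> b \<and> b \<le> p ! (a - 1)}"

definition multipartitions :: "nat \<Rightarrow> nat list list set" where
  "multipartitions r = {L. length L = r \<and> (\<forall>p\<in>set L. is_partition p)}"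

text \<open>
  Multicharges are integer lists \<open>s\<close> of length \<open>r\<close>. Components of multicharges and of
  multipartitions are numbered \<open>0, \<dots>, r - 1\<close>, as list positions are.
\<close>

definition nodes :: "nat list list \<Rightarrow> (nat \<times> nat \<times> nat) set" where
  "nodes L = {(a, b, j). j < length L \<and> (a, b) \<in> young_diagram (L ! j)}"

text \<open>
  The integers modulo \<open>e\<close> are represented by \<open>{0..<int e}\<close>. The index \<open>i\<close> of
  \<open>residue_count\<close> may be any integer and is read modulo \<open>e\<close>.
\<close>

definition residue :: "nat \<Rightarrow> int list \<Rightarrow> nat \<times> nat \<times> nat \<Rightarrow> int" where
  "residue e s = (\<lambda>(a, b, j). (int b - int a + s ! j) mod int e)"

definition residue_count :: "nat \<Rightarrow> int list \<Rightarrow> nat list list \<Rightarrow> int \<Rightarrow> nat" where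
  "residue_count e s L i = card {n \<in> nodes L. residue e s n = i mod int e}"

definition weight :: "nat \<Rightarrow> int list \<Rightarrow> nat list list \<Rightarrow> real" where
  "weight e s L =
     (\<Sum>j<length s. real (residue_count e s L (s ! j)))
     - (1/2) * (\<Sum>i\<in>{0..<int e}.
         (real (residue_count e s L i) - real (residue_count e s L (i + 1)))\<^sup>2)"

text \<open>
  The root lattice is the free abelian group on \<open>{0..<int e}\<close>, realised inside the finitely
  supported functions \<open>int \<Rightarrow>\<^sub>0 int\<close>, with basis vectors \<open>frag_of i\<close>.
\<close>

definition null_root :: "nat \<Rightarrow> int \<Rightarrow>\<^sub>0 int" where
  "null_root e = (\<Sum>i\<in>{0..<int e}. frag_of i)"

definition content :: "nat \<Rightarrow> int list \<Rightarrow> nat list list \<Rightarrow> int \<Rightarrow>\<^sub>0 int" where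
  "content e s L = (\<Sum>i\<in>{0..<int e}. frag_cmul (int (residue_count e s L i)) (frag_of i))"

definition contents :: "nat \<Rightarrow> int list \<Rightarrow> (int \<Rightarrow>\<^sub>0 int) set" where
  "contents e s = content e s ` multipartitions (length s)"

definition reduced_multicore :: "nat \<Rightarrow> int list \<Rightarrow> nat list list \<Rightarrow> bool" where
  "reduced_multicore e s L \<longleftrightarrow>
     L \<in> multipartitions (length s) \<and> content e s L - null_root e \<notin> contents e s"

text \<open>
  The supremum is taken in the extended reals, so that no finiteness is presupposed: an
  equation with a real number includes the finiteness of the supremum.
\<close>

definition max_weight :: "nat \<Rightarrow> nat \<Rightarrow> ereal" where
  "max_weight r e = Sup {ereal (weight e s L) | s L. length s = r \<and> reduced_multicore e s L}"

text \<open>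
  Counting residues with \<open>card\<close> and taking \<open>Max\<close> over the natural vectors of norm \<open>r\<close> are
  meaningful because the sets involved are finite (and, for \<open>Max\<close>, nonempty).
\<close>

lemma finite_nodes: "finite (nodes L)"
proof -
  have "finite (young_diagram p)" for p
    by (rule finite_subset[of _ "SIGMA a:{..length p}. {..p ! (a - 1)}"])
       (auto simp: young_diagram_def)
  then have "finite (\<Union>j<length L. (\<lambda>(a, b). (a, b, j)) ` young_diagram (L ! j))"
    by blast
  then show ?thesis
    by (rule rev_finite_subset) (force simp: nodes_def)
qed

lemma finite_nat_vectors_norm_one: "finite {x \<in> nat_vectors e. norm_one e x = real r}"
proof -
  have "{x \<in> nat_vectors e. norm_one e x = real r} \<subseteq> (Pow {1..e} \<rightarrow>\<^sub>E real ` {..r})"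
  proof (rule subsetI, rule PiE_I)
    fix x E assume x: "x \<in> {x \<in> nat_vectors e. norm_one e x = real r}" and E: "E \<in> Pow {1..e}"
    have "\<bar>x E\<bar> \<le> norm_one e x"
      unfolding norm_one_def using E by (intro member_le_sum) auto
    moreover have "x E \<in> \<nat>"
      using x E PiE_mem[of x "Pow {1..e}" "\<lambda>_. \<nat>" E] by (simp add: nat_vectors_def)
    then obtain n where "x E = real n"
      by (rule Nats_cases)
    ultimately show "x E \<in> real ` {..r}"
      using x by auto
  qed (auto simp: nat_vectors_def)
  then show ?thesis
    by (rule finite_subset) (simp add: finite_PiE)
qed

lemma nat_vectors_norm_one_nonempty: "{x \<in> nat_vectors e. norm_one e x = real r} \<noteq> {}"
proof -
  let ?x = "\<lambda>E\<in>Pow {1..e}. if E = {} then real r else 0"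
  have "norm_one e ?x = (\<Sum>E\<in>Pow {1..e}. if E = {} then real r else 0)"
    unfolding norm_one_def by (rule sum.cong) auto
  then have "norm_one e ?x = real r"
    by simp
  moreover have "?x \<in> nat_vectors e"
    by (auto simp: nat_vectors_def)
  ultimately show ?thesis
    by blast
qed

end

theory Submission
  imports Defs "HOL-Combinatorics.Cycles"
begin

text \<open>
  The proof reads multipartitions off an abacus with \<open>e\<close> runners. For one partition with
  charge \<open>\<sigma>\<close>, let \<open>c\<^sub>i\<close> be its residue counts and let the level of runner \<open>i\<close>
  be \<open>v\<^sub>i = c\<^sub>i - c\<^sub>i\<^sub>+\<^sub>1 + [i < \<sigma> mod e]\<close>: the number of beads on that runner,
  relative to a common base line. The levels sum to \<open>\<sigma> mod e\<close>, and \<open>c\<^sub>0\<close> is the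
  total height of the beads above that of the empty partition. Beads on a runner have distinct
  heights, so \<open>2 c\<^sub>0 \<ge> \<Sum> v\<^sub>i (v\<^sub>i - 1)\<close> (\<open>energy_le_count\<close>), and packing
  the beads without gaps shows that every integer vector with the right sum occurs with equality
  (\<open>ex_partition_levels\<close>). The levels and \<open>c\<^sub>0\<close> together determine all \<open>c\<^sub>i\<close>, and
  a rim \<open>e\<close>-hook raises every \<open>c\<^sub>i\<close> by one (\<open>ex_add_hooks\<close>).

  For an \<open>r\<close>-multipartition the levels form an integer matrix \<open>v\<^sub>j\<^sub>i\<close> with prescribed row
  sums, and its content fixes the column sums together with \<open>c\<^sub>0\<close>. If the multipartition is
  a reduced multicore, then no matrix with the same row and column sums has an energy
  \<open>\<Sum> v\<^sub>j\<^sub>i (v\<^sub>j\<^sub>i - 1)\<close> below \<open>2 c\<^sub>0\<close>: otherwise packing the beads for the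
  cheaper matrix and adding rim hooks would realise the content minus the null root
  (\<open>reduced_multicore_minimal\<close>). So \<open>2 c\<^sub>0\<close> is the energy of \<open>v\<close> and \<open>v\<close> is an
  optimal solution of a transportation problem with separable convex cost. Integral duality
  (\<open>optimal_transport_levels\<close>) then gives integers \<open>a\<^sub>j\<close>, \<open>b\<^sub>i\<close> and sets \<open>E\<^sub>j\<close>
  with \<open>v\<^sub>j\<^sub>i = a\<^sub>j + b\<^sub>i + [i \<in> E\<^sub>j]\<close>.

  When \<open>2 c\<^sub>0\<close> equals the energy, Lagrange's identity turns four times the weight into a
  sum over ordered pairs of components of \<open>|v\<^sub>j - v\<^sub>k|\<^sup>2 - |u\<^sub>j - u\<^sub>k|\<^sup>2\<close>, where \<open>u\<close> is the level matrix
  of the empty multipartition (\<open>weight_eq_discrepancies\<close>). For two-valued levels as above such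
  a term is twice \<open>w(E\<^sub>j, E\<^sub>k)\<close> (\<open>pair_discrepancy\<close>), so the weight of a reduced
  multicore is \<open>q\<^sub>e\<close> at the vector that counts how often each subset occurs among the
  \<open>E\<^sub>j\<close>. Conversely, subsets \<open>E\<^sub>1, \<dots>, E\<^sub>r\<close> are realised by levels in \<open>{0, 1}\<close>; these
  have \<open>c\<^sub>0 = 0\<close>, so that the null root cannot be subtracted and the multicore is reduced
  (\<open>ex_reduced_multicore\<close>). Hence the weights of reduced multicores and the values of \<open>q\<^sub>e\<close>
  on natural vectors of norm \<open>r\<close> are the same finite set of numbers. The values of
  \<open>q\<^sub>e\<close> are natural numbers because \<open>w\<close> is a symmetric matrix of natural numbers with zero
  diagonal.
\<close>

section \<open>Counting residues in a row\<close>

lemma div_diff_pred: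
  fixes x e :: int
  assumes "e > 0"
  shows "x div e - (x - 1) div e = of_bool (e dvd x)"
proof (cases "e dvd x")
  case True
  then obtain q where q: "x = e * q" by blast
  have "(e * q - 1) div e = q - 1"
    using assms by (intro int_div_pos_eq[of _ _ _ "e - 1"]) (auto simp: algebra_simps)
  with q True assms show ?thesis by simp
next
  case False
  define m where "m = x mod e"
  define k where "k = x div e"
  have x: "x = e * k + m" by (simp add: m_def k_def)
  have "0 \<le> m" "m < e" using assms by (simp_all add: m_def)
  moreover have "m \<noteq> 0" using False by (auto simp: m_def)
  ultimately have "0 \<le> m - 1" "m - 1 < e" by linarith+
  then have "(x - 1) div e = k"
    by (intro int_div_pos_eq[of _ _ _ "m - 1"]) (simp_all add: x)
  with False show ?thesis by (simp add: k_def)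
qed

text \<open>
  Each passage of \<open>b + t - i\<close> through a multiple of \<open>e\<close> raises the quotient by one, so the
  number of hits is a difference of two quotients. This turns residue counts into sums of
  quotients over beads.
\<close>

lemma card_residue_interval:
  fixes e k :: nat and t i :: int
  assumes "e > 0"
  shows "int (card {b \<in> {1..k}. (int b + t) mod int e = i mod int e}) =
         (int k + t - i) div int e - (t - i) div int e"
proof (induction k)
  case (Suc k)
  have "{b \<in> {1..Suc k}. (int b + t) mod int e = i mod int e} =
        {b \<in> {1..k}. (int b + t) mod int e = i mod int e} \<union>
        (if int e dvd (int (Suc k) + t - i) then {Suc k} else {})"
    by (auto simp: le_Suc_eq mod_eq_dvd_iff)
  then have "int (card {b \<in> {1..Suc k}. (int b + t) mod int e = i mod int e}) =
      int (card {b \<in> {1..k}. (int b + t) mod int e = i mod int e}) + of_bool (int e dvd (int (Suc k) + t - i))"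
    by auto
  moreover have "(int (Suc k) + t - i) div int e - (int k + t - i) div int e
      = of_bool (int e dvd (int (Suc k) + t - i))"
    using div_diff_pred[of "int e" "int (Suc k) + t - i"] assms by (simp add: algebra_simps)
  ultimately show ?case using Suc by simp
qed simp

section \<open>Residue counts of a partition and its beads\<close>

definition padded_part :: "nat list \<Rightarrow> nat \<Rightarrow> nat" where
  "padded_part p a = (if a < length p then p ! a else 0)"

definition component_count :: "nat \<Rightarrow> int \<Rightarrow> nat list \<Rightarrow> int \<Rightarrow> nat" where
  "component_count e s p i =
     (\<Sum>a<length p. card {b \<in> {1..p ! a}. (int b + (s - 1 - int a)) mod int e = i mod int e})"

lemma residue_count_eq_sum:
  "residue_count e s L i = (\<Sum>j<length L. component_count e (s ! j) (L ! j) i)"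
proof -
  let ?B = "\<lambda>j a. {b \<in> {1..L ! j ! a}. (int b + (s ! j - 1 - int a)) mod int e = i mod int e}"
  let ?S = "SIGMA j:{..<length L}. SIGMA a:{..<length (L ! j)}. ?B j a"
  let ?g = "\<lambda>(j, a, b). (Suc a, b, j)"
  have "?g ` ?S = {n \<in> nodes L. residue e s n = i mod int e}"
  proof (intro equalityI subsetI)
    fix n assume "n \<in> ?g ` ?S"
    then show "n \<in> {n \<in> nodes L. residue e s n = i mod int e}"
      by (auto simp: nodes_def young_diagram_def residue_def algebra_simps)
  next
    fix n assume n: "n \<in> {n \<in> nodes L. residue e s n = i mod int e}"
    obtain a b j where abj: "n = (a, b, j)" by (cases n)
    with n obtain a' where a': "a = Suc a'"
      by (cases a) (auto simp: nodes_def young_diagram_def)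
    have "(j, a', b) \<in> ?S"
      using n unfolding abj a' by (auto simp: nodes_def young_diagram_def residue_def algebra_simps)
    then show "n \<in> ?g ` ?S"
      unfolding abj a' by (rule rev_image_eqI) simp
  qed
  then have "residue_count e s L i = card (?g ` ?S)"
    by (simp add: residue_count_def)
  also have "\<dots> = card ?S"
    by (rule card_image) (auto simp: inj_on_def)
  also have "\<dots> = (\<Sum>j<length L. component_count e (s ! j) (L ! j) i)"
    by (simp add: component_count_def)
  finally show ?thesis .
qed

lemma component_count_eq_sum:
  assumes "e > 0" "length p \<le> n"
  shows "int (component_count e s p i) =
    (\<Sum>a<n. (int (padded_part p a) + (s - 1 - int a) - i) div int e - ((s - 1 - int a) - i) div int e)"
proof -
  have "int (component_count e s p i) =
    (\<Sum>a<length p. (int (padded_part p a) + (s - 1 - int a) - i) div int e - ((s - 1 - int a) - i) div int e)"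
    unfolding component_count_def of_nat_sum
    by (rule sum.cong) (use assms(1) card_residue_interval in \<open>auto simp: padded_part_def\<close>)
  also have "\<dots> = (\<Sum>a<n. (int (padded_part p a) + (s - 1 - int a) - i) div int e - ((s - 1 - int a) - i) div int e)"
    using assms(2) by (intro sum.mono_neutral_left) (auto simp: padded_part_def)
  finally show ?thesis .
qed

text \<open>
  The beta-set of \<open>p\<close> with \<open>n\<close> beads. Its members are natural numbers; the charge enters
  only through the choice of \<open>n\<close>, which is taken congruent to the charge modulo \<open>e\<close>.
\<close>

definition beads :: "nat \<Rightarrow> nat list \<Rightarrow> nat set" where
  "beads n p = (\<lambda>a. padded_part p a + (n - 1 - a)) ` {..<n}"

lemma padded_part_antimono:
  assumes "is_partition p" "a \<le> b"
  shows "padded_part p b \<le> padded_part p a"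
  using assms by (auto simp: padded_part_def is_partition_def sorted_wrt_iff_nth_less le_less)

lemma inj_on_beads:
  assumes "is_partition p"
  shows "inj_on (\<lambda>a. padded_part p a + (n - 1 - a)) {..<n}"
proof (rule linorder_inj_onI)
  fix a b assume "a < b" "a \<in> {..<n}" "b \<in> {..<n}"
  then show "padded_part p a + (n - 1 - a) \<noteq> padded_part p b + (n - 1 - b)"
    using padded_part_antimono[OF assms, of a b] by auto
qed auto

text \<open>
  A row of the diagram moves one bead from its place in the empty partition to its final place,
  and it meets residue \<open>i\<close> whenever the bead passes from runner \<open>i - 1\<close> to runner \<open>i\<close>. So
  \<open>c\<^sub>i\<close> compares the quotients \<open>(x - i) div e\<close> over the two bead sets. The congruence
  between \<open>n\<close> and \<open>s\<close> makes bead positions and contents agree modulo \<open>e\<close>.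
\<close>

lemma component_count_beads:
  assumes "e > 0" "is_partition p" "length p \<le> n" "int e dvd s - int n"
  shows "int (component_count e s p i) =
    (\<Sum>x\<in>beads n p. (int x - i) div int e) - (\<Sum>x<n. (int x - i) div int e)"
proof -
  obtain K where K: "s = int n + int e * K"
    using assms(4) by (metis dvdE add.commute diff_add_cancel)
  have shift: "(y + (s - 1 - int a) - i) div int e = (y + int (n - 1 - a) - i) div int e + K"
    if "a < n" for y a
  proof -
    have "y + (s - 1 - int a) - i = (y + int (n - 1 - a) - i) + K * int e"
      using that by (simp add: K algebra_simps)
    then show ?thesis using assms(1) by (simp only: div_mult_self1)
  qed
  have "int (component_count e s p i) =
    (\<Sum>a<n. (int (padded_part p a) + (s - 1 - int a) - i) div int e - (0 + (s - 1 - int a) - i) div int e)"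
    using component_count_eq_sum[OF assms(1,3), of s i] by simp
  also have "\<dots> = (\<Sum>a<n. (int (padded_part p a + (n - 1 - a)) - i) div int e - (int (n - Suc a) - i) div int e)"
    by (rule sum.cong) (simp_all only: shift lessThan_iff of_nat_add, simp add: add.commute)
  also have "\<dots> = (\<Sum>a<n. (int (padded_part p a + (n - 1 - a)) - i) div int e) - (\<Sum>x<n. (int x - i) div int e)"
    by (simp only: sum_subtractf sum.nat_diff_reindex[of "\<lambda>x. (int x - i) div int e"])
  also have "(\<Sum>a<n. (int (padded_part p a + (n - 1 - a)) - i) div int e) = (\<Sum>x\<in>beads n p. (int x - i) div int e)"
    unfolding beads_def by (subst sum.reindex[OF inj_on_beads[OF assms(2)]]) simp
  finally show ?thesis .
qed

lemma beads_Cons: "beads (Suc n) (x # p) = insert (x + n) (beads n p)"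
proof -
  have "(\<lambda>a. padded_part (x # p) a + (Suc n - 1 - a)) ` Suc ` {..<n} = beads n p"
    unfolding beads_def image_image by (rule image_cong) (auto simp: padded_part_def)
  then show ?thesis
    by (simp add: beads_def lessThan_Suc_eq_insert_0 padded_part_def)
qed

text \<open>
  The largest bead determines the first row, and the remaining beads determine the remaining
  rows. If the largest of \<open>n + 1\<close> beads sits at \<open>n\<close>, there are no gaps and the partition is
  empty.
\<close>

lemma ex_partition_beads:
  assumes "finite X" "card X = n"
  shows "\<exists>p. is_partition p \<and> length p \<le> n \<and> beads n p = X"
  using assms
proof (induction n arbitrary: X)
  case 0
  then show ?case by (intro exI[of _ "[]"]) (auto simp: beads_def is_partition_def)
next
  case (Suc n)
  define M where "M = Max X"
  have M: "M \<in> X" "\<And>x. x \<in> X \<Longrightarrow> x \<le> M"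
    using Suc.prems by (auto simp: M_def intro: Max_in)
  then have sub: "X \<subseteq> {..M}" by auto
  with Suc.prems have "n \<le> M"
    using card_mono[of "{..M}" X] by simp
  from M Suc.prems have "card (X - {M}) = n" by simp
  with Suc.IH[of "X - {M}"] Suc.prems obtain p
    where p: "is_partition p" "length p \<le> n" "beads n p = X - {M}" by auto
  show ?case
  proof (cases "M = n")
    case True
    then have "X = {..n}"
      using sub Suc.prems by (intro card_subset_eq) auto
    moreover have "beads (Suc n) [] = {..n}"
    proof -
      have "x \<in> (\<lambda>a. n - a) ` {..<Suc n}" if "x \<le> n" for x
        using that by (intro image_eqI[of _ _ "n - x"]) auto
      then show ?thesis by (auto simp: beads_def padded_part_def)
    qed
    ultimately show ?thesis by (intro exI[of _ "[]"]) (auto simp: is_partition_def)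
  next
    case False
    with \<open>n \<le> M\<close> have "n < M" by simp
    have "y \<le> M - n" if "y \<in> set p" for y
    proof -
      from that obtain h t where ht: "p = h # t" by (cases p) auto
      with p have n: "0 < n" by simp
      have "padded_part p 0 + (n - 1 - 0) \<in> beads n p"
        unfolding beads_def by (rule imageI) (use n in simp)
      then have "h + (n - 1) \<in> X" "h + (n - 1) \<noteq> M"
        using p ht by (auto simp: padded_part_def)
      then have "h + (n - 1) < M" using M(2)[of "h + (n - 1)"] by simp
      then have "h \<le> M - n" using n by simp
      moreover have "y \<le> h" using that p(1) ht by (auto simp: is_partition_def)
      ultimately show ?thesis by simp
    qed
    then have "is_partition ((M - n) # p)"
      using p(1) \<open>n < M\<close> by (auto simp: is_partition_def)
    moreover have "beads (Suc n) ((M - n) # p) = X"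
      using beads_Cons[of n "M - n" p] p(3) M(1) \<open>n < M\<close> by auto
    ultimately show ?thesis using p(2) by (intro exI[of _ "(M - n) # p"]) auto
  qed
qed

text \<open>
  Lengthening the first row by \<open>e * k\<close> keeps the shape a partition and adds \<open>k\<close> nodes of every
  residue.
\<close>

lemma ex_add_hooks:
  assumes "e > 0" "is_partition p"
  shows "\<exists>q. is_partition q \<and> (\<forall>i. component_count e s q i = component_count e s p i + k)"
proof -
  define q where "q = (padded_part p 0 + e * k) # tl p"
  show ?thesis
  proof (cases "k = 0")
    case True
    then show ?thesis using assms by auto
  next
    case False
    have "is_partition q"
      using assms False by (cases p) (auto simp: q_def padded_part_def is_partition_def)
    moreover have "component_count e s q i = component_count e s p i + k" for i
    proof -
      define n where "n = length p"
      let ?f = "\<lambda>p a. (int (padded_part p a) + (s - 1 - int a) - i) div int e - ((s - 1 - int a) - i) div int e"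
      have q0: "padded_part q 0 = padded_part p 0 + e * k" and qa: "padded_part q (Suc a) = padded_part p (Suc a)" for a
        by (cases p; simp add: q_def padded_part_def)+
      have "int (component_count e s q i) = ?f q 0 + (\<Sum>a<n. ?f q (Suc a))"
        using component_count_eq_sum[of e q "Suc n" s i] assms
        by (simp add: q_def n_def sum.lessThan_Suc_shift del: sum.lessThan_Suc)
      also have "?f q 0 = ?f p 0 + int k"
      proof -
        have "int (padded_part q 0) + (s - 1 - int 0) - i = (int (padded_part p 0) + (s - 1 - int 0) - i) + int k * int e"
          by (simp add: q0 algebra_simps)
        then show ?thesis using assms by (simp only: div_mult_self1)
      qed
      also have "?f p 0 + int k + (\<Sum>a<n. ?f q (Suc a)) = int (component_count e s p i + k)"
        using component_count_eq_sum[of e p "Suc n" s i] assms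
        by (simp add: n_def qa sum.lessThan_Suc_shift del: sum.lessThan_Suc)
      finally show ?thesis by simp
    qed
    ultimately show ?thesis by blast
  qed
qed

section \<open>Runner levels of an abacus\<close>

text \<open>
  The beads of an \<open>e\<close>-core: runner \<open>i\<close> is filled without gaps up to height \<open>k i\<close>.
\<close>

definition packed_beads :: "nat \<Rightarrow> (nat \<Rightarrow> nat) \<Rightarrow> nat set" where
  "packed_beads e k = (\<lambda>(i, l). i + e * l) ` (SIGMA i:{..<e}. {..<k i})"

lemma sum_packed_beads: "(\<Sum>x\<in>packed_beads e k. f x) = (\<Sum>i<e. \<Sum>l<k i. f (i + e * l))"
proof -
  have "inj_on (\<lambda>(i, l). i + e * l) (SIGMA i:{..<e}. {..<k i})"
  proof (rule inj_onI)
    fix u v assume uv: "u \<in> (SIGMA i:{..<e}. {..<k i})" "v \<in> (SIGMA i:{..<e}. {..<k i})"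
      and eq: "(\<lambda>(i, l). i + e * l) u = (\<lambda>(i, l). i + e * l) v"
    have "(x + e * y) mod e = x" "(x + e * y) div e = y" if "x < e" for x y
      using that by auto
    moreover obtain i l i' l' where "u = (i, l)" "v = (i', l')" by (metis surj_pair)
    moreover from calculation uv eq have "i < e" "i' < e" "i + e * l = i' + e * l'" by simp_all
    ultimately show "u = v" by metis
  qed
  then show ?thesis
    unfolding packed_beads_def by (simp add: sum.reindex sum.Sigma case_prod_unfold)
qed

lemma finite_packed_beads: "finite (packed_beads e k)"
  by (simp add: packed_beads_def)

lemma card_packed_beads: "card (packed_beads e k) = (\<Sum>i<e. k i)"
  unfolding card_eq_sum sum_packed_beads by simp

lemma sum_packed_beads_runner:
  assumes "i < e"
  shows "(\<Sum>x\<in>packed_beads e k. of_bool (x mod e = i)) = int (k i)"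
proof -
  have "(\<Sum>x\<in>packed_beads e k. of_bool (x mod e = i)) = (\<Sum>i'<e. \<Sum>l<k i'. of_bool (i' = i))"
    unfolding sum_packed_beads by (intro sum.cong) auto
  also have "\<dots> = (\<Sum>i'<e. if i' = i then int (k i') else 0)"
    by (intro sum.cong) auto
  also have "\<dots> = int (k i)" using assms by simp
  finally show ?thesis .
qed

lemma sum_packed_beads_height: "2 * (\<Sum>x\<in>packed_beads e k. int (x div e)) = (\<Sum>i<e. int (k i) * (int (k i) - 1))"
proof -
  have gauss: "2 * (\<Sum>l<m. int l) = int m * (int m - 1)" for m
    by (induction m) (auto simp: algebra_simps)
  have "(\<Sum>x\<in>packed_beads e k. int (x div e)) = (\<Sum>i<e. \<Sum>l<k i. int l)"
    unfolding sum_packed_beads by (intro sum.cong) auto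
  then have "2 * (\<Sum>x\<in>packed_beads e k. int (x div e)) = (\<Sum>i<e. 2 * (\<Sum>l<k i. int l))"
    by (simp only: sum_distrib_left)
  then show ?thesis by (simp only: gauss)
qed

text \<open>
  The bead set of the empty partition is itself packed, so that all formulas for packed beads apply
  to it; it gives the reference levels and the reference height.
\<close>

lemma lessThan_eq_packed_beads:
  assumes "c < e"
  shows "{..<e * N + c} = packed_beads e (\<lambda>i. N + of_bool (i < c))"
proof (intro equalityI subsetI)
  fix x assume "x \<in> {..<e * N + c}"
  then have lt: "x mod e + e * (x div e) < e * N + c" by simp
  have "x div e < N + of_bool (x mod e < c)"
  proof (rule ccontr)
    assume "\<not> ?thesis"
    then have "Suc N \<le> x div e \<or> x div e = N \<and> \<not> x mod e < c"
      by (cases "x mod e < c") auto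
    then consider "Suc N \<le> x div e" | "x div e = N" "\<not> x mod e < c"
      by blast
    then show False
    proof cases
      case 1
      then have "e * Suc N \<le> e * (x div e)" by (rule mult_le_mono2)
      moreover have "e * (x div e) < e * N + c" using lt by (rule le_less_trans[OF le_add2])
      ultimately show False using assms unfolding mult_Suc_right by linarith
    next
      case 2
      with lt show False by simp
    qed
  qed
  then have "(x mod e, x div e) \<in> (SIGMA i:{..<e}. {..<N + of_bool (i < c)})"
    using assms by (metis SigmaI lessThan_iff mod_less_divisor not_less_zero gr_zeroI)
  then show "x \<in> packed_beads e (\<lambda>i. N + of_bool (i < c))"
    unfolding packed_beads_def by (rule rev_image_eqI) simp
next
  fix x assume "x \<in> packed_beads e (\<lambda>i. N + of_bool (i < c))"
  then obtain i l where il: "x = i + e * l" "i < e" "l < N + of_bool (i < c)"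
    by (auto simp: packed_beads_def)
  show "x \<in> {..<e * N + c}"
  proof (cases "l < N")
    case True
    then have "e * Suc l \<le> e * N" by (intro mult_le_mono2) simp
    with il show ?thesis by simp
  next
    case False
    with il have "l = N" "i < c" by (auto split: if_splits simp: of_bool_def)
    with il show ?thesis by simp
  qed
qed

lemma card_le_sum_nat_set:
  assumes "finite Y"
  shows "int (card Y) * (int (card Y) - 1) \<le> 2 * (\<Sum>y\<in>Y. int y)"
  using assms
proof (induction "card Y" arbitrary: Y)
  case (Suc n)
  then have Y: "finite Y" "Y \<noteq> {}" "card Y = Suc n" by auto
  then have M: "Max Y \<in> Y" by simp
  have "Y \<subseteq> {..Max Y}" using Y by auto
  then have "card Y \<le> Suc (Max Y)" using card_mono[of "{..Max Y}" Y] by simp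
  then have "n \<le> Max Y" using Y by simp
  moreover have "int n * (int n - 1) \<le> 2 * (\<Sum>y\<in>Y - {Max Y}. int y)"
    using Suc.hyps(1)[of "Y - {Max Y}"] Y M by simp
  moreover have "(\<Sum>y\<in>Y. int y) = int (Max Y) + (\<Sum>y\<in>Y - {Max Y}. int y)"
    using Y M by (simp add: sum.remove)
  ultimately show ?case using Y by (simp add: algebra_simps)
qed simp

lemma component_count_mod: "component_count e s p (i mod int e) = component_count e s p i"
  by (simp add: component_count_def)

text \<open>
  The levels of the empty partition. A charge matters only modulo \<open>e\<close>, so these are normalised to
  the values 0 and 1.
\<close>

definition vacuum :: "nat \<Rightarrow> int \<Rightarrow> nat \<Rightarrow> int" where
  "vacuum e s i = of_bool (int i < s mod int e)"

text \<open>
  Defined through residue counts, so that the connection with contents is immediate; the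
  description by beads is \<open>level_beads\<close>.
\<close>

definition level :: "nat \<Rightarrow> int \<Rightarrow> nat list \<Rightarrow> nat \<Rightarrow> int" where
  "level e s p i =
     int (component_count e s p (int i)) - int (component_count e s p (int i + 1)) + vacuum e s i"

lemma sum_vacuum:
  assumes "e > 0"
  shows "(\<Sum>i<e. vacuum e s i) = s mod int e"
proof -
  have "{i. i < e \<and> int i < s mod int e} = {..<nat (s mod int e)}"
    using pos_mod_bound[of "int e" s] assms
    by (intro set_eqI) (simp only: mem_Collect_eq lessThan_iff zless_nat_eq_int_zless, linarith)
  then have "(\<Sum>i<e. vacuum e s i) = int (nat (s mod int e))"
    by (simp add: vacuum_def of_bool_def sum.If_cases Int_def)
  then show ?thesis using assms by simp
qed

lemma sum_level:
  assumes "e > 0"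
  shows "(\<Sum>i<e. level e s p i) = s mod int e"
proof -
  have "(\<Sum>i<e. int (component_count e s p (int i)) - int (component_count e s p (int (Suc i))))
     = int (component_count e s p 0) - int (component_count e s p (int e))"
    by (subst sum_lessThan_telescope') simp
  also have "component_count e s p (int e) = component_count e s p 0"
    using component_count_mod[of e s p "int e"] by simp
  finally show ?thesis
    using sum_vacuum[OF assms, of s] by (simp add: level_def sum.distrib add.commute)
qed

text \<open>
  A bead number congruent to the charge, and as large as needed; \<open>N\<close> is the common base line of
  the runners.
\<close>

lemma ex_bead_number:
  assumes "e > 0"
  obtains N n where "n = e * N + nat (s mod int e)" "k \<le> N" "k \<le> n"
proof
  show "k \<le> k" "k \<le> e * k + nat (s mod int e)"
    using assms by (simp_all add: trans_le_add1)
qed simp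

context
  fixes e N n :: nat and s :: int and p :: "nat list"
  assumes e: "e > 0" and p: "is_partition p" "length p \<le> n"
    and n: "n = e * N + nat (s mod int e)"
begin

lemma lessThan_beads: "{..<n} = packed_beads e (\<lambda>i. N + of_bool (int i < s mod int e))"
proof -
  have "nat (s mod int e) < e" using e pos_mod_bound[of "int e" s] by (simp add: nat_less_iff)
  then show ?thesis
    unfolding n lessThan_eq_packed_beads[OF \<open>nat (s mod int e) < e\<close>] using e
    by (simp add: zless_nat_eq_int_zless)
qed

lemma dvd_charge: "int e dvd s - int n"
proof -
  have "s - int n = int e * (s div int e - int N)"
    using e mult_div_mod_eq[of "int e" s] by (simp add: n algebra_simps)
  then show ?thesis by simp
qed

lemma level_beads:
  assumes "i < e"
  shows "level e s p i = (\<Sum>x\<in>beads n p. of_bool (x mod e = i)) - int N"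
proof -
  have step: "(int x - int i) div int e - (int x - (int i + 1)) div int e = of_bool (x mod e = i)" for x
  proof -
    have "int e dvd int x - int i \<longleftrightarrow> x mod e = i"
      using assms by (simp add: mod_eq_dvd_iff[symmetric] zmod_int[symmetric])
    then show ?thesis
      using div_diff_pred[of "int e" "int x - int i"] e by (simp add: algebra_simps)
  qed
  have "int (component_count e s p (int i)) - int (component_count e s p (int i + 1)) =
     (\<Sum>x\<in>beads n p. (int x - int i) div int e - (int x - (int i + 1)) div int e)
     - (\<Sum>x<n. (int x - int i) div int e - (int x - (int i + 1)) div int e)"
    by (simp add: component_count_beads[OF e p dvd_charge] sum_subtractf)
  also have "\<dots> = (\<Sum>x\<in>beads n p. of_bool (x mod e = i)) - (int N + vacuum e s i)"
    unfolding step lessThan_beads sum_packed_beads_runner[OF assms] by (simp add: vacuum_def)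
  finally show ?thesis by (simp add: level_def)
qed

text \<open>
  The subtracted sum is twice the height of the empty partition, whose runner \<open>i\<close> carries
  \<open>N + vacuum e s i\<close> beads.
\<close>

lemma energy_beads:
  "2 * int (component_count e s p 0) =
     2 * (\<Sum>x\<in>beads n p. int (x div e)) - (\<Sum>i<e. int N * (int N - 1) + 2 * int N * vacuum e s i)"
proof -
  have "2 * int (component_count e s p 0) =
      2 * (\<Sum>x\<in>beads n p. int (x div e)) - 2 * (\<Sum>x<n. int (x div e))"
    by (simp add: component_count_beads[OF e p dvd_charge] zdiv_int)
  also have "2 * (\<Sum>x<n. int (x div e)) = (\<Sum>i<e. int N * (int N - 1) + 2 * int N * vacuum e s i)"
    unfolding lessThan_beads sum_packed_beads_height
    by (intro sum.cong) (auto simp: vacuum_def algebra_simps)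
  finally show ?thesis .
qed

text \<open>
  The two base-line contributions of order \<open>N\<close> cancel because the levels and the vacuum levels
  have the same sum.
\<close>

lemma energy_shift:
  assumes "(\<Sum>i<e. v i) = s mod int e"
  shows "(\<Sum>i<e. (int N + v i) * (int N + v i - 1)) - (\<Sum>i<e. int N * (int N - 1) + 2 * int N * vacuum e s i)
     = (\<Sum>i<e. v i * (v i - 1))"
proof -
  have "(\<Sum>i<e. (int N + v i) * (int N + v i - 1)) - (\<Sum>i<e. int N * (int N - 1) + 2 * int N * vacuum e s i)
     = (\<Sum>i<e. v i * (v i - 1)) + 2 * int N * ((\<Sum>i<e. v i) - (\<Sum>i<e. vacuum e s i))"
    by (simp add: sum_subtractf[symmetric] sum.distrib[symmetric] sum_distrib_left)
       (intro sum.cong, auto simp: algebra_simps)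
  then show ?thesis using assms sum_vacuum[OF e, of s] by simp
qed

lemma energy_le_beads: "(\<Sum>i<e. level e s p i * (level e s p i - 1)) \<le> 2 * int (component_count e s p 0)"
proof -
  let ?R = "\<lambda>i. {x \<in> beads n p. x mod e = i}"
  have fin: "finite (beads n p)" by (simp add: beads_def)
  have card_R: "int (card (?R i)) = int N + level e s p i" if "i < e" for i
    using level_beads[OF that] fin by (simp add: of_bool_def sum.If_cases Int_def)
  have bound: "int (card (?R i)) * (int (card (?R i)) - 1) \<le> 2 * (\<Sum>x\<in>?R i. int (x div e))" for i
  proof -
    have inj: "inj_on (\<lambda>x. x div e) (?R i)"
    proof (rule inj_onI)
      fix x y assume "x \<in> ?R i" "y \<in> ?R i" "x div e = y div e"
      then show "x = y" using div_mult_mod_eq[of x e] div_mult_mod_eq[of y e] by simp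
    qed
    have "2 * (\<Sum>x\<in>?R i. int (x div e)) = 2 * (\<Sum>y\<in>(\<lambda>x. x div e) ` ?R i. int y)"
      by (simp add: sum.reindex[OF inj])
    then show ?thesis
      using card_le_sum_nat_set[of "(\<lambda>x. x div e) ` ?R i"] fin by (simp add: card_image[OF inj])
  qed
  have "(\<Sum>i<e. (int N + level e s p i) * (int N + level e s p i - 1)) \<le> (\<Sum>i<e. 2 * (\<Sum>x\<in>?R i. int (x div e)))"
  proof (rule sum_mono)
    fix i assume "i \<in> {..<e}"
    then have "i < e" by simp
    show "(int N + level e s p i) * (int N + level e s p i - 1) \<le> 2 * (\<Sum>x\<in>?R i. int (x div e))"
      using bound[of i] unfolding card_R[OF \<open>i < e\<close>] .
  qed
  also have "\<dots> = 2 * (\<Sum>x\<in>beads n p. int (x div e))"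
    unfolding sum_distrib_left[symmetric]
    by (subst sum.group[of "beads n p" "{..<e}" "\<lambda>x. x mod e" "\<lambda>x. int (x div e)"])
       (use fin e in auto)
  finally show ?thesis
    using energy_shift[OF sum_level[OF e, of s p]] energy_beads by simp
qed

end

text \<open>
  The beads on a runner have distinct heights, so their total height is least when they are packed.
\<close>

lemma energy_le_count:
  assumes "e > 0" "is_partition p"
  shows "(\<Sum>i<e. level e s p i * (level e s p i - 1)) \<le> 2 * int (component_count e s p 0)"
proof -
  obtain N n where "n = e * N + nat (s mod int e)" "length p \<le> N" "length p \<le> n"
    by (rule ex_bead_number[OF assms(1)])
  then show ?thesis by (intro energy_le_beads[OF assms])
qed

text \<open>
  Packed runners: the partition is the \<open>e\<close>-core with the given levels.
\<close>

lemma ex_partition_levels: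
  assumes e: "e > 0" and v: "(\<Sum>i<e. v i) = s mod int e"
  shows "\<exists>p. is_partition p \<and> (\<forall>i<e. level e s p i = v i) \<and>
    2 * int (component_count e s p 0) = (\<Sum>i<e. v i * (v i - 1))"
proof -
  obtain N n where n: "n = e * N + nat (s mod int e)" and N: "(\<Sum>i<e. nat \<bar>v i\<bar>) \<le> N"
      "(\<Sum>i<e. nat \<bar>v i\<bar>) \<le> n"
    by (rule ex_bead_number[OF e])
  have pos: "0 \<le> int N + v i" if "i < e" for i
  proof -
    have "nat \<bar>v i\<bar> \<le> (\<Sum>i<e. nat \<bar>v i\<bar>)" using that by (intro member_le_sum) auto
    with N(1) show ?thesis by linarith
  qed
  define k where "k i = nat (int N + v i)" for i
  have k: "int (k i) = int N + v i" if "i < e" for i using pos[OF that] by (simp add: k_def)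
  have "int (card (packed_beads e k)) = int n"
  proof -
    have "int (card (packed_beads e k)) = (\<Sum>i<e. int N + v i)"
      unfolding card_packed_beads of_nat_sum by (intro sum.cong) (auto simp: k)
    then show ?thesis using v e by (simp add: n sum.distrib)
  qed
  then obtain p where p: "is_partition p" "length p \<le> n" "beads n p = packed_beads e k"
    using ex_partition_beads[OF finite_packed_beads, of e k n] by auto
  note abacus = e p(1,2) n
  have "level e s p i = v i" if "i < e" for i
    using level_beads[OF abacus that] sum_packed_beads_runner[OF that] k[OF that] p(3) by simp
  moreover have "2 * (\<Sum>x\<in>beads n p. int (x div e)) = (\<Sum>i<e. (int N + v i) * (int N + v i - 1))"
    unfolding p(3) sum_packed_beads_height by (intro sum.cong) (auto simp: k)
  then have "2 * int (component_count e s p 0) = (\<Sum>i<e. v i * (v i - 1))"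
    using energy_beads[OF abacus] energy_shift[OF abacus v] by simp
  ultimately show ?thesis using p(1) by blast
qed

section \<open>Potentials and optimal integer transport\<close>

definition walk_cost :: "('a \<Rightarrow> 'a \<Rightarrow> int) \<Rightarrow> 'a list \<Rightarrow> int" where
  "walk_cost D xs = sum_list (map2 D xs (tl xs))"

lemma walk_cost_Cons [simp]: "walk_cost D (x # y # xs) = D x y + walk_cost D (y # xs)"
  by (simp add: walk_cost_def)

lemma walk_cost_append: "walk_cost D (xs @ y # ys) = walk_cost D (xs @ [y]) + walk_cost D (y # ys)"
proof (induction xs)
  case Nil
  then show ?case by (simp add: walk_cost_def)
next
  case (Cons x xs)
  then show ?case by (cases xs) (auto simp: walk_cost_def)
qed

text \<open>
  A simple closed walk is a permutation that fixes everything off the walk; fixed points cost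
  nothing.
\<close>

lemma sum_cycle_of_list:
  assumes "finite S" "distinct (x # xs)" "set (x # xs) \<subseteq> S" and D: "\<And>j. j \<in> S \<Longrightarrow> D j j = (0::int)"
  shows "(\<Sum>j\<in>S. D j (cycle_of_list (x # xs) j)) = walk_cost D (x # xs @ [x])"
proof -
  let ?c = "x # xs"
  have "(\<Sum>j\<in>S. D j (cycle_of_list ?c j)) = (\<Sum>j\<in>set ?c. D j (cycle_of_list ?c j))"
    using assms by (intro sum.mono_neutral_right) (auto simp del: cycle_of_list.simps simp: id_outside_supp D)
  also have "\<dots> = sum_list (map (\<lambda>j. D j (cycle_of_list ?c j)) ?c)"
    using assms(2) by (simp add: sum_list_distinct_conv_sum_set del: cycle_of_list.simps)
  also have "\<dots> = sum_list (map2 D ?c (map (cycle_of_list ?c) ?c))"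
    by (simp add: zip_map2 zip_same_conv_map comp_def case_prod_unfold del: cycle_of_list.simps)
  also have "map (cycle_of_list ?c) ?c = rotate1 ?c"
    using cyclic_rotation[OF assms(2), of 1] by (simp del: cycle_of_list.simps)
  also have "sum_list (map2 D ?c (rotate1 ?c)) = walk_cost D (x # xs @ [x])"
    using zip_append1[of "x # xs" "[x]" "xs @ [x]"] by (simp add: walk_cost_def)
  finally show ?thesis .
qed

text \<open>
  Shortest-path potentials, or duality for the assignment problem: a system of difference
  constraints is solvable when no closed walk has negative cost. It suffices to know this for
  simple closed walks, hence for permutations, because the potential of \<open>j\<close> is taken to be the
  least cost of a simple walk that starts at \<open>j\<close>.
\<close>

lemma ex_potential:
  fixes D :: "'a \<Rightarrow> 'a \<Rightarrow> int"
  assumes S: "finite S" and diag: "\<And>j. j \<in> S \<Longrightarrow> D j j = 0"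
    and opt: "\<And>\<pi>. \<pi> permutes S \<Longrightarrow> 0 \<le> (\<Sum>j\<in>S. D j (\<pi> j))"
  shows "\<exists>a. \<forall>j\<in>S. \<forall>k\<in>S. a j - a k \<le> D j k"
proof -
  define P where "P j = {xs. set (j # xs) \<subseteq> S \<and> distinct (j # xs)}" for j
  define a where "a j = Min ((\<lambda>xs. walk_cost D (j # xs)) ` P j)" for j
  have fin: "finite (P j)" for j
    by (rule finite_subset[OF _ finite_subset_distinct[OF S]]) (auto simp: P_def)
  have a_le: "a j \<le> walk_cost D (j # xs)" if "xs \<in> P j" for j xs
    using that fin by (simp add: a_def)
  have ex: "\<exists>xs\<in>P j. a j = walk_cost D (j # xs)" if "j \<in> S" for j
  proof -
    have "[] \<in> P j" using that by (simp add: P_def)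
    then have "a j \<in> (\<lambda>xs. walk_cost D (j # xs)) ` P j"
      unfolding a_def using fin by (intro Min_in) auto
    then show ?thesis by auto
  qed
  have cycle: "0 \<le> walk_cost D (x # xs @ [x])" if "distinct (x # xs)" "set (x # xs) \<subseteq> S" for x xs
  proof -
    have "cycle_of_list (x # xs) permutes S"
      using cycle_permutes that(2) by (rule permutes_subset)
    then show ?thesis
      using opt[of "cycle_of_list (x # xs)"] sum_cycle_of_list[OF S that, of D] diag by (simp del: cycle_of_list.simps)
  qed
  have "a j - a k \<le> D j k" if "j \<in> S" "k \<in> S" for j k
  proof -
    obtain xs where xs: "xs \<in> P k" "a k = walk_cost D (k # xs)" using ex[OF \<open>k \<in> S\<close>] by blast
    show ?thesis
    proof (cases "j \<in> set (k # xs)")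
      \<comment> \<open>A cheapest walk from \<open>k\<close> is prolonged by the edge from \<open>j\<close>.\<close>
      case False
      then have "k # xs \<in> P j" using xs that by (auto simp: P_def)
      from a_le[OF this] xs show ?thesis by simp
    next
      \<comment> \<open>The prolonged walk closes a cycle at \<open>j\<close>; cutting it off does not raise the cost.\<close>
      case True
      then obtain ys zs where split: "k # xs = ys @ j # zs" by (meson split_list)
      have "a k = walk_cost D (ys @ [j]) + walk_cost D (j # zs)"
        using xs split walk_cost_append[of D ys j zs] by simp
      moreover have "0 \<le> D j k + walk_cost D (ys @ [j])"
      proof (cases ys)
        case Nil
        then show ?thesis using split diag that by (simp add: walk_cost_def)
      next
        case (Cons y ys')
        with split have "y = k" by simp
        have "distinct (ys @ j # zs)" "set (ys @ j # zs) \<subseteq> S"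
          using xs(1) split[symmetric] by (auto simp: P_def)
        then have "0 \<le> walk_cost D (j # ys @ [j])"
          by (intro cycle) auto
        then show ?thesis using Cons \<open>y = k\<close> by simp
      qed
      moreover have "a j \<le> walk_cost D (j # zs)"
      proof (rule a_le)
        have "distinct (ys @ j # zs)" "set (ys @ j # zs) \<subseteq> S"
          using xs(1) split[symmetric] by (auto simp: P_def)
        then show "zs \<in> P j" by (auto simp: P_def)
      qed
      ultimately show ?thesis by simp
    qed
  qed
  then show ?thesis by blast
qed

text \<open>
  The cost \<open>m (m - 1)\<close> is convex and its increments are the even integers \<open>2 m\<close>, so optimality
  is certified by integral potentials. Write \<open>D j k\<close> for half the formal cost of moving one unit
  from row \<open>k\<close> to row \<open>j\<close> in the cheapest column. A permutation \<open>\<pi>\<close> describes a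
  simultaneous exchange in which each moved row \<open>j\<close> gains a unit in column \<open>out j\<close> and loses one
  in column \<open>inn j\<close>. It preserves all row and column sums and costs at most twice the sum of the
  \<open>D j (\<pi> j)\<close>, so these sums are nonnegative. The potentials \<open>a\<close> obtained from
  \<open>ex_potential\<close> say that any two rows of \<open>m j i - a j\<close> differ by at most one in each column.
\<close>

lemma optimal_transport_levels:
  fixes m :: "nat \<Rightarrow> nat \<Rightarrow> int"
  assumes e: "e > 0"
    and opt: "\<And>m'. (\<forall>j<r. (\<Sum>i<e. m' j i) = (\<Sum>i<e. m j i)) \<Longrightarrow>
        (\<forall>i<e. (\<Sum>j<r. m' j i) = (\<Sum>j<r. m j i)) \<Longrightarrow>
        (\<Sum>j<r. \<Sum>i<e. m j i * (m j i - 1)) \<le> (\<Sum>j<r. \<Sum>i<e. m' j i * (m' j i - 1))"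
  shows "\<exists>a b E. \<forall>j<r. \<forall>i<e. m j i = a j + b i + of_bool (i \<in> E j)"
proof -
  define c where "c j k = arg_min_on (\<lambda>i. m j i - m k i) {..<e}" for j k
  have c: "c j k < e" "i < e \<Longrightarrow> m j (c j k) - m k (c j k) \<le> m j i - m k i" for j k i
  proof -
    have "finite {..<e}" "{..<e} \<noteq> {}" using e by auto
    from arg_min_if_finite(1)[OF this, of "\<lambda>i. m j i - m k i"] show "c j k < e"
      unfolding c_def by simp
    show "m j (c j k) - m k (c j k) \<le> m j i - m k i" if "i < e"
      using arg_min_least[OF \<open>finite {..<e}\<close> \<open>{..<e} \<noteq> {}\<close>, of i "\<lambda>i. m j i - m k i"] that
      unfolding c_def by simp
  qed
  define D where "D j k = (if j = k then 0 else 1 + (m j (c j k) - m k (c j k)))" for j k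
  have "0 \<le> (\<Sum>j<r. D j (\<pi> j))" if \<pi>: "\<pi> permutes {..<r}" for \<pi>
  proof -
    define q where "q = inv \<pi>"
    have q\<pi>: "q (\<pi> j) = j" "\<pi> (q j) = j" for j
      using permutes_inverses[OF \<pi>] by (auto simp: q_def)
    have reindex: "(\<Sum>j<r. f j) = (\<Sum>j<r. f (\<pi> j))" for f :: "nat \<Rightarrow> int"
      using sum.permute[OF \<pi>, of f] by (simp add: o_def)
    define out where "out j = c j (\<pi> j)" for j
    define inn where "inn j = c (q j) j" for j
    define d where "d j i = (of_bool (i = out j) - of_bool (i = inn j) :: int)" for j i
    have oi: "out j < e" "inn j < e" for j by (simp_all add: out_def inn_def c)
    have pick: "(\<Sum>i<e. f i * of_bool (i = x)) = f x" if "x < e" for f :: "nat \<Rightarrow> int" and x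
      using that by simp
    have inn_\<pi>: "inn (\<pi> j) = out j" for j by (simp add: inn_def out_def q\<pi>)
    have row: "(\<Sum>i<e. d j i) = 0" for j
      using oi pick[of _ "\<lambda>_. 1"] by (simp add: d_def sum_subtractf)
    have col: "(\<Sum>j<r. d j i) = 0" for i
      using reindex[of "\<lambda>j. of_bool (i = inn j)"] by (simp add: d_def sum_subtractf inn_\<pi>)
    have "0 \<le> (\<Sum>j<r. \<Sum>i<e. (m j i + d j i) * (m j i + d j i - 1)) - (\<Sum>j<r. \<Sum>i<e. m j i * (m j i - 1))"
      using opt[of "\<lambda>j i. m j i + d j i"] by (simp add: sum.distrib row col)
    also have "\<dots> = (\<Sum>j<r. (\<Sum>i<e. 2 * (m j i * d j i) + d j i * d j i) - (\<Sum>i<e. d j i))"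
      unfolding sum_subtractf[symmetric] by (intro sum.cong refl) (simp add: algebra_simps)
    also have "\<dots> = (\<Sum>j<r. 2 * m j (out j) - 2 * m j (inn j) + (\<Sum>i<e. d j i * d j i))"
    proof (intro sum.cong refl)
      fix j
      have "(\<Sum>i<e. m j i * d j i) = m j (out j) - m j (inn j)"
        by (simp add: d_def right_diff_distrib sum_subtractf pick oi)
      then show "(\<Sum>i<e. 2 * (m j i * d j i) + d j i * d j i) - (\<Sum>i<e. d j i)
          = 2 * m j (out j) - 2 * m j (inn j) + (\<Sum>i<e. d j i * d j i)"
        by (simp add: row sum.distrib sum_distrib_left[symmetric])
    qed
    also have "\<dots> \<le> (\<Sum>j<r. 2 * m j (out j) - 2 * m j (inn j) + 2 * of_bool (\<pi> j \<noteq> j))"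
    proof (intro sum_mono add_left_mono)
      fix j
      \<comment> \<open>If gain and loss of a row fall into the same column, they cancel; hence the inequality.\<close>
      show "(\<Sum>i<e. d j i * d j i) \<le> 2 * of_bool (\<pi> j \<noteq> j)"
      proof (cases "\<pi> j = j")
        case True
        then have "out j = inn j" using q\<pi>(1)[of j] by (simp add: out_def inn_def)
        then show ?thesis by (simp add: d_def)
      next
        case False
        have "(\<Sum>i<e. d j i * d j i) \<le> (\<Sum>i<e. 1 * of_bool (i = out j) + 1 * of_bool (i = inn j))"
          by (intro sum_mono) (auto simp: d_def)
        also have "\<dots> = 2" unfolding sum.distrib pick[OF oi(1)] pick[OF oi(2)] by simp
        finally show ?thesis using False by simp
      qed
    qed
    also have "\<dots> = 2 * (\<Sum>j<r. m j (out j)) - 2 * (\<Sum>j<r. m j (inn j)) + 2 * (\<Sum>j<r. of_bool (\<pi> j \<noteq> j))"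
      by (simp add: sum.distrib sum_subtractf sum_distrib_left)
    also have "(\<Sum>j<r. m j (inn j)) = (\<Sum>j<r. m (\<pi> j) (out j))"
      using reindex[of "\<lambda>j. m j (inn j)"] by (simp add: inn_\<pi>)
    also have "2 * (\<Sum>j<r. m j (out j)) - 2 * (\<Sum>j<r. m (\<pi> j) (out j)) + 2 * (\<Sum>j<r. of_bool (\<pi> j \<noteq> j))
        = 2 * (\<Sum>j<r. D j (\<pi> j))"
      unfolding sum_distrib_left sum_subtractf[symmetric] sum.distrib[symmetric]
      by (intro sum.cong refl) (auto simp: D_def out_def algebra_simps)
    finally show ?thesis by simp
  qed
  then obtain a where a: "\<And>j k. j < r \<Longrightarrow> k < r \<Longrightarrow> a j - a k \<le> D j k"
    using ex_potential[of "{..<r}" D] by (auto simp: D_def)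
  have spread: "(m k i - a k) - (m j i - a j) \<le> 1" if "j < r" "k < r" "i < e" for j k i
  proof (cases "j = k")
    case False
    then show ?thesis using a[OF that(1,2)] c(2)[OF that(3), of j k] by (simp add: D_def)
  qed simp
  define b where "b i = Min ((\<lambda>j. m j i - a j) ` {..<r})" for i
  have b: "m j i = a j + b i + of_bool (m j i \<noteq> a j + b i)" if "j < r" "i < e" for j i
  proof -
    have "b i \<in> (\<lambda>j. m j i - a j) ` {..<r}"
      unfolding b_def using that by (intro Min_in) auto
    then obtain k where k: "k < r" "b i = m k i - a k" by auto
    have "b i \<le> m j i - a j" using that by (simp add: b_def)
    moreover have "m j i - a j \<le> b i + 1" using spread[of k j i] that k by simp
    ultimately show ?thesis by (cases "m j i = a j + b i") auto
  qed
  show ?thesis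
    by (intro exI[of _ a] exI[of _ b] exI[of _ "\<lambda>j. {i. m j i \<noteq> a j + b i}"]) (use b in auto)
qed

section \<open>Quadratic form and families of subsets\<close>

lemma even_symmetric_sum:
  fixes f :: "'a \<Rightarrow> 'a \<Rightarrow> int"
  assumes "finite A" "\<And>a b. f a b = f b a" "\<And>a. a \<in> A \<Longrightarrow> f a a = 0"
  shows "even (\<Sum>a\<in>A. \<Sum>b\<in>A. f a b)"
  using assms(1,3)
proof (induction A)
  case (insert z A)
  have "(\<Sum>a\<in>insert z A. \<Sum>b\<in>insert z A. f a b) = 2 * (\<Sum>a\<in>A. f a z) + (\<Sum>a\<in>A. \<Sum>b\<in>A. f a b)"
  proof -
    have "(\<Sum>b\<in>A. f z b) = (\<Sum>a\<in>A. f a z)" by (intro sum.cong refl assms(2))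
    then show ?thesis using insert by (simp add: sum.distrib)
  qed
  then show ?case using insert by simp
qed simp

lemma set_weight_self: "set_weight E E = 0"
  by (simp add: set_weight_def)

lemma set_weight_commute: "set_weight E F = set_weight F E"
  by (simp add: set_weight_def Int_commute min.commute)

lemma set_weight_nonneg:
  assumes "finite E" "finite F"
  shows "0 \<le> set_weight E F"
  using assms card_mono[of E "E \<inter> F"] card_mono[of F "E \<inter> F"] by (simp add: set_weight_def)

lemma nat_vectors_multiplicity:
  assumes "x \<in> nat_vectors e"
  obtains n where "\<And>E. E \<in> Pow {1..e} \<Longrightarrow> x E = real (n E)"
proof -
  have "\<forall>E\<in>Pow {1..e}. \<exists>n. x E = real n"
    using assms PiE_mem[of x "Pow {1..e}" "\<lambda>_. \<nat>"] by (metis Nats_cases nat_vectors_def)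
  then show ?thesis using that bchoice[of "Pow {1..e}"] by metis
qed

text \<open>
  The off-diagonal entries of a symmetric matrix occur in pairs, which cancels the factor one half.
\<close>

lemma quad_form_Nats:
  assumes "x \<in> nat_vectors e"
  shows "quad_form e x \<in> \<nat>"
proof -
  obtain n where n: "\<And>E. E \<in> Pow {1..e} \<Longrightarrow> x E = real (n E)"
    using nat_vectors_multiplicity[OF assms] by blast
  define T where "T = (\<Sum>E\<in>Pow {1..e}. \<Sum>F\<in>Pow {1..e}. set_weight E F * int (n E) * int (n F))"
  have "even T"
    unfolding T_def
    by (rule even_symmetric_sum) (auto simp: set_weight_self set_weight_commute)
  moreover have "0 \<le> T"
    unfolding T_def
    by (intro sum_nonneg mult_nonneg_nonneg set_weight_nonneg) (auto intro: finite_subset)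
  ultimately obtain m where "T = 2 * int m"
    by (metis evenE nonneg_int_cases zero_le_mult_iff zero_less_numeral not_less)
  moreover have "quad_form e x = of_int T / 2"
    unfolding quad_form_def T_def by (simp add: n)
  ultimately show ?thesis by simp
qed

text \<open>
  A vector of natural numbers and norm \<open>r\<close> is the multiplicity function of a family of \<open>r\<close> subsets.
  This lemma and the following ones translate between the two; families are what the components
  of a multipartition provide.
\<close>

lemma sum_multiplicity:
  fixes r :: nat
  assumes "finite A" "f ` {..<r} \<subseteq> A"
  shows "(\<Sum>a\<in>A. real (card {j. j < r \<and> f j = a}) * g a) = (\<Sum>j<r. g (f j))"
proof -
  have "(\<Sum>j<r. g (f j)) = (\<Sum>a\<in>A. \<Sum>j | j \<in> {..<r} \<and> f j = a. g (f j))"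
    using assms by (intro sum.group[symmetric]) auto
  also have "\<dots> = (\<Sum>a\<in>A. real (card {j. j < r \<and> f j = a}) * g a)"
    by (intro sum.cong) auto
  finally show ?thesis by simp
qed

lemma quad_form_family:
  fixes r :: nat
  assumes "f ` {..<r} \<subseteq> Pow {1..e}"
    and x: "\<And>E. E \<in> Pow {1..e} \<Longrightarrow> x E = real (card {j. j < r \<and> f j = E})"
  shows "quad_form e x = of_int (\<Sum>j<r. \<Sum>k<r. set_weight (f j) (f k)) / 2"
proof -
  have "(\<Sum>E\<in>Pow {1..e}. \<Sum>F\<in>Pow {1..e}. of_int (set_weight E F) * x E * x F)
      = (\<Sum>E\<in>Pow {1..e}. x E * (\<Sum>F\<in>Pow {1..e}. x F * of_int (set_weight E F)))"
    unfolding sum_distrib_left by (intro sum.cong refl) (simp add: mult_ac)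
  also have "\<dots> = (\<Sum>E\<in>Pow {1..e}. real (card {j. j < r \<and> f j = E}) * (\<Sum>k<r. of_int (set_weight E (f k))))"
  proof (intro sum.cong refl)
    fix E assume "E \<in> Pow {1..e}"
    have "(\<Sum>F\<in>Pow {1..e}. x F * of_int (set_weight E F))
        = (\<Sum>F\<in>Pow {1..e}. real (card {j. j < r \<and> f j = F}) * of_int (set_weight E F))"
      by (intro sum.cong refl) (simp only: x)
    also have "\<dots> = (\<Sum>k<r. of_int (set_weight E (f k)))"
      by (rule sum_multiplicity) (use assms(1) in auto)
    finally show "x E * (\<Sum>F\<in>Pow {1..e}. x F * of_int (set_weight E F))
        = real (card {j. j < r \<and> f j = E}) * (\<Sum>k<r. of_int (set_weight E (f k)))"
      using x[OF \<open>E \<in> Pow {1..e}\<close>] by simp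
  qed
  also have "\<dots> = (\<Sum>j<r. \<Sum>k<r. of_int (set_weight (f j) (f k)))"
    by (rule sum_multiplicity) (use assms(1) in auto)
  finally show ?thesis by (simp add: quad_form_def)
qed

lemma ex_vector_of_family:
  fixes r :: nat
  assumes "f ` {..<r} \<subseteq> Pow {1..e}"
  shows "\<exists>x\<in>nat_vectors e. norm_one e x = real r \<and>
    quad_form e x = of_int (\<Sum>j<r. \<Sum>k<r. set_weight (f j) (f k)) / 2"
proof
  define x where "x = (\<lambda>E\<in>Pow {1..e}. real (card {j. j < r \<and> f j = E}))"
  have x: "x E = real (card {j. j < r \<and> f j = E})" if "E \<in> Pow {1..e}" for E
    using that by (simp add: x_def)
  show "x \<in> nat_vectors e" by (auto simp: nat_vectors_def x_def)
  have "norm_one e x = (\<Sum>E\<in>Pow {1..e}. real (card {j. j < r \<and> f j = E}) * 1)"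
    unfolding norm_one_def by (intro sum.cong refl) (simp add: x del: Pow_iff)
  also have "\<dots> = (\<Sum>j<r. 1)"
    by (rule sum_multiplicity) (use assms in auto)
  finally show "norm_one e x = real r \<and>
    quad_form e x = of_int (\<Sum>j<r. \<Sum>k<r. set_weight (f j) (f k)) / 2"
    using quad_form_family[OF assms x] by simp
qed

lemma ex_family_multiplicity:
  assumes "finite A" "(\<Sum>a\<in>A. n a) = r"
  shows "\<exists>f. f ` {..<r} \<subseteq> A \<and> (\<forall>a\<in>A. card {j. j < r \<and> f j = a} = n a)"
proof -
  let ?S = "SIGMA a:A. {..<n a}"
  have "card ?S = r" "finite ?S" using assms by auto
  then obtain h where h: "bij_betw h {..<r} ?S"
    using ex_bij_betw_nat_finite[of ?S] by (auto simp: atLeast0LessThan)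
  then have mem: "h j \<in> ?S" if "j < r" for j
    using that by (meson bij_betwE lessThan_iff)
  have "card {j. j < r \<and> fst (h j) = a} = n a" if "a \<in> A" for a
  proof -
    have "h ` {j. j < r \<and> fst (h j) = a} = {a} \<times> {..<n a}"
    proof (intro equalityI subsetI)
      fix y assume "y \<in> h ` {j. j < r \<and> fst (h j) = a}"
      then show "y \<in> {a} \<times> {..<n a}" using mem by fastforce
    next
      fix y assume y: "y \<in> {a} \<times> {..<n a}"
      then have "y \<in> ?S" using that by auto
      then obtain j where "j < r" "h j = y"
        using h unfolding bij_betw_def by (metis imageE lessThan_iff)
      with y show "y \<in> h ` {j. j < r \<and> fst (h j) = a}" by auto
    qed
    moreover have "card (h ` {j. j < r \<and> fst (h j) = a}) = card {j. j < r \<and> fst (h j) = a}"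
      using h by (intro card_image) (auto simp: bij_betw_def intro: inj_on_subset)
    ultimately show ?thesis by simp
  qed
  moreover have "(fst \<circ> h) ` {..<r} \<subseteq> A" using mem by fastforce
  ultimately show ?thesis by (intro exI[of _ "fst \<circ> h"]) auto
qed

lemma ex_family_of_vector:
  assumes "x \<in> nat_vectors e" "norm_one e x = real r"
  shows "\<exists>f. f ` {..<r} \<subseteq> Pow {1..e} \<and>
    quad_form e x = of_int (\<Sum>j<r. \<Sum>k<r. set_weight (f j) (f k)) / 2"
proof -
  obtain n where n: "\<And>E. E \<in> Pow {1..e} \<Longrightarrow> x E = real (n E)"
    using nat_vectors_multiplicity[OF assms(1)] by blast
  have "real (\<Sum>E\<in>Pow {1..e}. n E) = real r"
    using assms(2) by (simp add: norm_one_def n)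
  then have "(\<Sum>E\<in>Pow {1..e}. n E) = r"
    by (simp only: of_nat_eq_iff)
  then obtain f where f: "f ` {..<r} \<subseteq> Pow {1..e}"
      "\<And>E. E \<in> Pow {1..e} \<Longrightarrow> card {j. j < r \<and> f j = E} = n E"
    using ex_family_multiplicity[of "Pow {1..e}" n r] by auto
  then show ?thesis
    using quad_form_family[OF f(1), of x] n by auto
qed

section \<open>Weight of a multipartition in terms of levels\<close>

lemma sum_of_bool_Suc_mem:
  assumes "E \<subseteq> {1..e}"
  shows "(\<Sum>i<e. of_bool (Suc i \<in> E)) = int (card E)"
proof -
  have "(\<Sum>i<e. of_bool (Suc i \<in> E)) = (\<Sum>t\<in>{1..e}. of_bool (t \<in> E) :: int)"
    by (simp add: sum.atLeast1_atMost_eq)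
  also have "\<dots> = int (card ({1..e} \<inter> E))"
    by (simp add: of_bool_def sum.If_cases)
  also have "{1..e} \<inter> E = E" using assms by auto
  finally show ?thesis .
qed

text \<open>
  The constant \<open>A\<close> is the only freedom beyond the two sets. The charges are reduced modulo \<open>e\<close>,
  hence differ by less than \<open>e\<close>, and \<open>|E|\<close> and \<open>|F|\<close> differ by at most \<open>e\<close>. This leaves
  \<open>A \<in> {-1, 0, 1}\<close>, and in each case the contribution of \<open>A\<close> is offset by the change in
  the vacuum term, so that the result depends on \<open>E\<close> and \<open>F\<close> only.
\<close>

lemma pair_discrepancy:
  assumes e: "e > 0" and EF: "E \<subseteq> {1..e}" "F \<subseteq> {1..e}"
    and v: "(\<Sum>i<e. v i) = s mod int e" and w: "(\<Sum>i<e. w i) = t mod int e"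
    and diff: "\<And>i. i < e \<Longrightarrow> v i - w i = A + of_bool (Suc i \<in> E) - of_bool (Suc i \<in> F)"
  shows "(\<Sum>i<e. (v i - w i)\<^sup>2 - (vacuum e s i - vacuum e t i)\<^sup>2) = 2 * set_weight E F"
proof -
  define S where "S = int (card E) - int (card F)"
  define I where "I = int (card (E \<inter> F))"
  have "E \<inter> F \<subseteq> {1..e}" using EF by blast
  note count = sum_of_bool_Suc_mem[OF EF(1)] sum_of_bool_Suc_mem[OF EF(2)] sum_of_bool_Suc_mem[OF this]
  have "(\<Sum>i<e. v i - w i) = (\<Sum>i<e. A + of_bool (Suc i \<in> E) - of_bool (Suc i \<in> F))"
    by (intro sum.cong) (auto simp: diff)
  then have D: "s mod int e - t mod int e = int e * A + S"
    by (simp add: sum_subtractf sum.distrib v w count S_def del: sum_of_bool_eq)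
  have sq: "(\<Sum>i<e. (v i - w i)\<^sup>2) = int e * A\<^sup>2 + 2 * A * S + (int (card E) + int (card F) - 2 * I)"
  proof -
    have "(\<Sum>i<e. (v i - w i)\<^sup>2) = (\<Sum>i<e. A\<^sup>2 + 2 * A * (of_bool (Suc i \<in> E) - of_bool (Suc i \<in> F))
        + (of_bool (Suc i \<in> E) + of_bool (Suc i \<in> F) - 2 * of_bool (Suc i \<in> E \<inter> F)))"
      by (intro sum.cong refl) (auto simp: diff power2_eq_square algebra_simps)
    then show ?thesis
      by (simp add: sum_subtractf sum.distrib sum_distrib_left[symmetric] count
          S_def I_def del: Int_iff sum_of_bool_eq)
  qed
  have vac: "(\<Sum>i<e. (vacuum e s i - vacuum e t i)\<^sup>2) = \<bar>s mod int e - t mod int e\<bar>"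
  proof (cases "s mod int e \<le> t mod int e")
    case True
    then have "(\<Sum>i<e. (vacuum e s i - vacuum e t i)\<^sup>2) = (\<Sum>i<e. vacuum e t i - vacuum e s i)"
      by (intro sum.cong) (auto simp: vacuum_def)
    then show ?thesis using True by (simp add: sum_subtractf sum_vacuum[OF e])
  next
    case False
    then have "(\<Sum>i<e. (vacuum e s i - vacuum e t i)\<^sup>2) = (\<Sum>i<e. vacuum e s i - vacuum e t i)"
      by (intro sum.cong) (auto simp: vacuum_def)
    then show ?thesis using False by (simp add: sum_subtractf sum_vacuum[OF e])
  qed
  have S: "\<bar>S\<bar> \<le> int e"
    using card_mono[OF _ EF(1)] card_mono[OF _ EF(2)] by (simp add: S_def)
  have bound: "\<bar>int e * A + S\<bar> < int e"
    using e pos_mod_bound[of "int e" s] pos_mod_bound[of "int e" t]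
      pos_mod_sign[of "int e" s] pos_mod_sign[of "int e" t] unfolding D[symmetric] by linarith
  have "\<bar>A\<bar> < 2"
  proof (rule ccontr)
    assume "\<not> \<bar>A\<bar> < 2"
    then have "int e * 2 \<le> int e * \<bar>A\<bar>" by (intro mult_left_mono) auto
    also have "\<dots> = \<bar>int e * A\<bar>" by (simp add: abs_mult)
    finally show False using S bound by linarith
  qed
  then consider "A = 0" | "A = 1" | "A = -1" by linarith
  then have "int e * A\<^sup>2 + 2 * A * S - \<bar>int e * A + S\<bar> = - \<bar>S\<bar>"
    using S bound by cases auto
  moreover have "2 * set_weight E F = int (card E) + int (card F) - 2 * I - \<bar>S\<bar>"
    by (simp add: set_weight_def S_def I_def min_def)
  ultimately show ?thesis
    unfolding sum_subtractf sq vac D by linarith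
qed

lemma sum_square_differences:
  fixes x :: "nat \<Rightarrow> int"
  shows "(\<Sum>j<r. \<Sum>k<r. (x j - x k)\<^sup>2) = 2 * int r * (\<Sum>j<r. (x j)\<^sup>2) - 2 * (\<Sum>j<r. x j)\<^sup>2"
proof -
  have "(\<Sum>j<r. \<Sum>k<r. (x j - x k)\<^sup>2) = (\<Sum>j<r. \<Sum>k<r. (x j)\<^sup>2 + (x k)\<^sup>2 - 2 * (x j * x k))"
    by (simp add: power2_diff mult.assoc)
  also have "\<dots> = 2 * int r * (\<Sum>j<r. (x j)\<^sup>2) - 2 * (\<Sum>j<r. \<Sum>k<r. x j * x k)"
    by (simp add: sum_subtractf sum.distrib sum_distrib_left[symmetric])
  also have "(\<Sum>j<r. \<Sum>k<r. x j * x k) = (\<Sum>j<r. x j)\<^sup>2"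
    by (simp add: power2_eq_square sum_product)
  finally show ?thesis .
qed

lemma residue_count_mod: "residue_count e s L (i mod int e) = residue_count e s L i"
  by (simp add: residue_count_def)

text \<open>
  The column sums of the level matrix determine the content up to a multiple of the null root,
  which is then fixed by the count of residue 0.
\<close>

lemma residue_count_step:
  "int (residue_count e s L (int i)) - int (residue_count e s L (int i + 1)) =
    (\<Sum>j<length L. level e (s ! j) (L ! j) i) - (\<Sum>j<length L. vacuum e (s ! j) i)"
  by (simp add: residue_count_eq_sum level_def sum_subtractf[symmetric] sum.distrib)

lemma residue_count_diff:
  "int (residue_count e s L 0) - int (residue_count e s L (int m)) =
    (\<Sum>i<m. int (residue_count e s L (int i)) - int (residue_count e s L (int i + 1)))"
  using sum_lessThan_telescope'[of "\<lambda>i. int (residue_count e s L (int i))" m]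
  by (simp add: add.commute)

text \<open>
  Let \<open>V\<close> and \<open>U\<close> be the column sums of levels and vacuum levels. The count of residue \<open>s ! j\<close>
  is \<open>c\<^sub>0\<close> minus the sum of \<open>V\<^sub>i - U\<^sub>i\<close> over the runners \<open>i\<close> whose vacuum level in
  component \<open>j\<close> is 1. Summing over the components gives
  \<open>2 weight = 2 r c\<^sub>0 - \<Sum> (V\<^sub>i\<^sup>2 - U\<^sub>i\<^sup>2)\<close>. The energy hypothesis makes
  \<open>2 c\<^sub>0\<close> the difference of the sums of squares of \<open>v\<close> and of \<open>u\<close>, and Lagrange's
  identity finishes the computation.
\<close>

lemma weight_eq_discrepancies:
  assumes e: "e > 0" and len: "length s = r" "length L = r"
    and v: "\<And>j i. j < r \<Longrightarrow> i < e \<Longrightarrow> v j i = level e (s ! j) (L ! j) i"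
    and energy: "2 * int (residue_count e s L 0) = (\<Sum>j<r. \<Sum>i<e. v j i * (v j i - 1))"
  shows "4 * weight e s L = of_int (\<Sum>j<r. \<Sum>k<r. \<Sum>i<e.
    (v j i - v k i)\<^sup>2 - (vacuum e (s ! j) i - vacuum e (s ! k) i)\<^sup>2)"
proof -
  define c where "c i = int (residue_count e s L i)" for i
  define u where "u j = vacuum e (s ! j)" for j
  define V where "V i = (\<Sum>j<r. v j i)" for i
  define U where "U i = (\<Sum>j<r. u j i)" for i
  have step: "c (int i) - c (int i + 1) = V i - U i" if "i < e" for i
    using residue_count_step[of e s L i] that v by (simp add: c_def V_def U_def u_def len)
  have c_charge: "c (s ! j) = c 0 - (\<Sum>i<e. u j i * (V i - U i))" for j
  proof -
    define m where "m = nat (s ! j mod int e)"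
    have m: "m < e" "int m = s ! j mod int e"
      using e pos_mod_bound[of "int e" "s ! j"] by (auto simp: m_def nat_less_iff)
    have "c 0 - c (int m) = (\<Sum>i<m. V i - U i)"
      unfolding c_def residue_count_diff
      by (intro sum.cong refl) (use step m(1) in \<open>simp add: c_def\<close>)
    also have "\<dots> = (\<Sum>i<e. u j i * (V i - U i))"
      using m by (intro sum.mono_neutral_cong_left)
        (auto simp: u_def vacuum_def m(2)[symmetric])
    finally show ?thesis
      using residue_count_mod[of e s L "s ! j"] by (simp add: c_def m(2))
  qed
  have "2 * weight e s L = of_int (2 * (\<Sum>j<r. c (s ! j)) - (\<Sum>i<e. (V i - U i)\<^sup>2))"
  proof -
    have "(\<Sum>i\<in>{0..<int e}. (real_of_int (c i) - real_of_int (c (i + 1)))\<^sup>2)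
        = (\<Sum>i\<in>int ` {0..<e}. (real_of_int (c i) - real_of_int (c (i + 1)))\<^sup>2)"
      by (simp add: image_int_atLeastLessThan)
    also have "\<dots> = (\<Sum>i<e. (of_int (c (int i) - c (int i + 1)))\<^sup>2)"
      by (simp add: sum.reindex atLeast0LessThan)
    also have "\<dots> = of_int (\<Sum>i<e. (V i - U i)\<^sup>2)"
      by (simp add: step)
    finally show ?thesis by (simp add: weight_def c_def len)
  qed
  moreover have "(\<Sum>j<r. c (s ! j)) = int r * c 0 - (\<Sum>i<e. U i * (V i - U i))"
  proof -
    have "(\<Sum>j<r. \<Sum>i<e. u j i * (V i - U i)) = (\<Sum>i<e. U i * (V i - U i))"
      unfolding U_def by (subst sum.swap) (simp add: sum_distrib_right)
    then show ?thesis by (simp add: c_charge sum_subtractf)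
  qed
  ultimately have "4 * weight e s L = of_int (2 * int r * (2 * c 0) - (\<Sum>i<e. 2 * (V i)\<^sup>2 - 2 * (U i)\<^sup>2))"
  proof -
    have "(\<Sum>i<e. 2 * (V i)\<^sup>2 - 2 * (U i)\<^sup>2) = 4 * (\<Sum>i<e. U i * (V i - U i)) + 2 * (\<Sum>i<e. (V i - U i)\<^sup>2)"
      unfolding sum_distrib_left sum.distrib[symmetric]
      by (intro sum.cong refl) (simp add: power2_eq_square algebra_simps)
    moreover assume "2 * weight e s L = of_int (2 * (\<Sum>j<r. c (s ! j)) - (\<Sum>i<e. (V i - U i)\<^sup>2))"
      "(\<Sum>j<r. c (s ! j)) = int r * c 0 - (\<Sum>i<e. U i * (V i - U i))"
    ultimately show ?thesis by simp
  qed
  moreover have "(\<Sum>j<r. \<Sum>k<r. \<Sum>i<e. (v j i - v k i)\<^sup>2 - (u j i - u k i)\<^sup>2)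
      = 2 * int r * (2 * c 0) - (\<Sum>i<e. 2 * (V i)\<^sup>2 - 2 * (U i)\<^sup>2)"
  proof -
    have swap: "(\<Sum>j<r. \<Sum>k<r. \<Sum>i<e. f j k i) = (\<Sum>i<e. \<Sum>j<r. \<Sum>k<r. f j k i)" for f :: "nat \<Rightarrow> nat \<Rightarrow> nat \<Rightarrow> int"
    proof -
      have "(\<Sum>j<r. \<Sum>k<r. \<Sum>i<e. f j k i) = (\<Sum>j<r. \<Sum>i<e. \<Sum>k<r. f j k i)"
        by (rule sum.cong[OF refl], rule sum.swap)
      also have "\<dots> = (\<Sum>i<e. \<Sum>j<r. \<Sum>k<r. f j k i)" by (rule sum.swap)
      finally show ?thesis .
    qed
    \<comment> \<open>The linear terms of the energies agree, and the vacuum has energy 0.\<close>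
    have "(\<Sum>j<r. \<Sum>i<e. v j i) = (\<Sum>j<r. \<Sum>i<e. u j i)"
      by (rule sum.cong[OF refl]) (simp add: v sum_level[OF e] u_def sum_vacuum[OF e])
    moreover have "(u j i)\<^sup>2 = u j i" for j i by (simp add: u_def vacuum_def)
    moreover have "(\<Sum>j<r. \<Sum>i<e. v j i * (v j i - 1)) = (\<Sum>j<r. \<Sum>i<e. (v j i)\<^sup>2) - (\<Sum>j<r. \<Sum>i<e. v j i)"
      by (simp add: power2_eq_square right_diff_distrib sum_subtractf)
    ultimately have "2 * c 0 = (\<Sum>j<r. \<Sum>i<e. (v j i)\<^sup>2) - (\<Sum>j<r. \<Sum>i<e. (u j i)\<^sup>2)"
      using energy by (simp add: c_def)
    moreover have "(\<Sum>j<r. \<Sum>k<r. \<Sum>i<e. (v j i - v k i)\<^sup>2 - (u j i - u k i)\<^sup>2)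
      = (\<Sum>i<e. (2 * int r * (\<Sum>j<r. (v j i)\<^sup>2) - 2 * (V i)\<^sup>2) - (2 * int r * (\<Sum>j<r. (u j i)\<^sup>2) - 2 * (U i)\<^sup>2))"
      unfolding swap V_def U_def sum_square_differences[symmetric] by (simp add: sum_subtractf)
    moreover have "\<dots> = 2 * int r * ((\<Sum>i<e. \<Sum>j<r. (v j i)\<^sup>2) - (\<Sum>i<e. \<Sum>j<r. (u j i)\<^sup>2))
        - (\<Sum>i<e. 2 * (V i)\<^sup>2 - 2 * (U i)\<^sup>2)"
      unfolding sum_distrib_left right_diff_distrib sum_subtractf[symmetric]
      by (intro sum.cong[OF refl]) (simp add: sum_subtractf)
    moreover have "(\<Sum>j<r. \<Sum>i<e. (v j i)\<^sup>2) = (\<Sum>i<e. \<Sum>j<r. (v j i)\<^sup>2)"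
      "(\<Sum>j<r. \<Sum>i<e. (u j i)\<^sup>2) = (\<Sum>i<e. \<Sum>j<r. (u j i)\<^sup>2)"
      by (rule sum.swap)+
    ultimately show ?thesis by simp
  qed
  ultimately show ?thesis by (simp add: u_def)
qed

lemma weight_of_two_valued_levels:
  assumes e: "e > 0" and len: "length s = r" "length L = r"
    and E: "\<And>j. j < r \<Longrightarrow> E j \<subseteq> {1..e}"
    and level: "\<And>j i. j < r \<Longrightarrow> i < e \<Longrightarrow> level e (s ! j) (L ! j) i = a j + b i + of_bool (Suc i \<in> E j)"
    and energy: "2 * int (residue_count e s L 0) =
      (\<Sum>j<r. \<Sum>i<e. level e (s ! j) (L ! j) i * (level e (s ! j) (L ! j) i - 1))"
  shows "weight e s L = of_int (\<Sum>j<r. \<Sum>k<r. set_weight (E j) (E k)) / 2"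
proof -
  let ?v = "\<lambda>j. level e (s ! j) (L ! j)"
  have pair: "(\<Sum>i<e. (?v j i - ?v k i)\<^sup>2 - (vacuum e (s ! j) i - vacuum e (s ! k) i)\<^sup>2)
      = 2 * set_weight (E j) (E k)" if "j < r" "k < r" for j k
    by (rule pair_discrepancy[where A = "a j - a k",
          OF e E[OF that(1)] E[OF that(2)] sum_level[OF e] sum_level[OF e]])
       (simp add: level that)
  have "4 * weight e s L = of_int (\<Sum>j<r. \<Sum>k<r. 2 * set_weight (E j) (E k))"
    unfolding weight_eq_discrepancies[OF e len refl energy]
    by (intro arg_cong[where f = of_int] sum.cong refl) (simp add: pair)
  then show ?thesis by (simp add: sum_distrib_left[symmetric])
qed

section \<open>Reduced multicores\<close>

lemma lookup_content:
  "Poly_Mapping.lookup (content e s L) i = (if i \<in> {0..<int e} then int (residue_count e s L i) else 0)"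
  by (simp add: content_def lookup_sum if_distrib[of "\<lambda>x. _ * x"] sum.If_cases cong: if_cong)

lemma lookup_null_root: "Poly_Mapping.lookup (null_root e) i = (if i \<in> {0..<int e} then 1 else 0)"
  by (simp add: null_root_def lookup_sum)

lemma reduced_multicore_iff:
  "reduced_multicore e s L \<longleftrightarrow> L \<in> multipartitions (length s) \<and>
    \<not> (\<exists>M\<in>multipartitions (length s). \<forall>i\<in>{0..<int e}. residue_count e s L i = residue_count e s M i + 1)"
proof -
  have "content e s L - null_root e = content e s M \<longleftrightarrow>
      (\<forall>i\<in>{0..<int e}. residue_count e s L i = residue_count e s M i + 1)" for M
    unfolding poly_mapping_eq_iff fun_eq_iff lookup_minus lookup_content lookup_null_root
    by (auto split: if_splits)
  then show ?thesis
    unfolding reduced_multicore_def contents_def image_iff by simp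
qed

lemma ex_multipartition_levels:
  assumes e: "e > 0"
    and v: "\<And>j. j < length s \<Longrightarrow> (\<Sum>i<e. v j i) = s ! j mod int e"
  shows "\<exists>L\<in>multipartitions (length s).
    (\<forall>j<length s. \<forall>i<e. level e (s ! j) (L ! j) i = v j i) \<and>
    2 * int (residue_count e s L 0) = (\<Sum>j<length s. \<Sum>i<e. v j i * (v j i - 1))"
proof -
  have "\<forall>j. \<exists>p. j < length s \<longrightarrow> is_partition p \<and> (\<forall>i<e. level e (s ! j) p i = v j i) \<and>
    2 * int (component_count e (s ! j) p 0) = (\<Sum>i<e. v j i * (v j i - 1))"
    using ex_partition_levels[OF e v] by blast
  from choice[OF this] obtain p where p: "\<And>j. j < length s \<Longrightarrow> is_partition (p j) \<and>
    (\<forall>i<e. level e (s ! j) (p j) i = v j i) \<and>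
    2 * int (component_count e (s ! j) (p j) 0) = (\<Sum>i<e. v j i * (v j i - 1))"
    by blast
  show ?thesis
  proof (intro bexI[of _ "map p [0..<length s]"] conjI)
    show "2 * int (residue_count e s (map p [0..<length s]) 0) = (\<Sum>j<length s. \<Sum>i<e. v j i * (v j i - 1))"
      by (simp add: residue_count_eq_sum sum_distrib_left p)
  qed (auto simp: p multipartitions_def)
qed

text \<open>
  A matrix of smaller energy is realised by \<open>e\<close>-cores whose content differs from that of \<open>L\<close> by
  a positive multiple of the null root. Adding all but one of these null roots back as rim hooks
  would give the content of \<open>L\<close> minus the null root.
\<close>

lemma reduced_multicore_minimal:
  assumes e: "e > 0" and "s \<noteq> []" and red: "reduced_multicore e s L"
    and rows: "\<And>j. j < length s \<Longrightarrow> (\<Sum>i<e. v j i) = s ! j mod int e"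
    and cols: "\<And>i. i < e \<Longrightarrow> (\<Sum>j<length s. v j i) = (\<Sum>j<length s. level e (s ! j) (L ! j) i)"
  shows "2 * int (residue_count e s L 0) \<le> (\<Sum>j<length s. \<Sum>i<e. v j i * (v j i - 1))"
proof (rule ccontr)
  assume less: "\<not> ?thesis"
  have L: "L \<in> multipartitions (length s)" using red by (simp add: reduced_multicore_def)
  obtain M where M: "M \<in> multipartitions (length s)"
      "\<And>j i. j < length s \<Longrightarrow> i < e \<Longrightarrow> level e (s ! j) (M ! j) i = v j i"
      "2 * int (residue_count e s M 0) = (\<Sum>j<length s. \<Sum>i<e. v j i * (v j i - 1))"
    using ex_multipartition_levels[OF e rows] by blast
  have len: "length L = length s" "length M = length s"
    using L M(1) by (auto simp: multipartitions_def)
  define k where "k = residue_count e s L 0 - residue_count e s M 0 - 1"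
  have k: "residue_count e s L 0 = residue_count e s M 0 + k + 1"
    using less M(3) by (simp add: k_def)
  have shift: "residue_count e s L i = residue_count e s M i + k + 1" if "i \<in> {0..<int e}" for i
  proof -
    define m where "m = nat i"
    have m: "i = int m" "m < e" using that by (auto simp: m_def)
    have "(\<Sum>i<m. int (residue_count e s L (int i)) - int (residue_count e s L (int i + 1)))
        = (\<Sum>i<m. int (residue_count e s M (int i)) - int (residue_count e s M (int i + 1)))"
      using m(2) by (intro sum.cong refl) (simp add: residue_count_step len cols M(2))
    then show ?thesis
      using residue_count_diff[of e s L m] residue_count_diff[of e s M m] k m(1) by simp
  qed
  have 0: "0 < length s" "0 < length M" using \<open>s \<noteq> []\<close> len by auto
  then have "is_partition (M ! 0)" using M(1) by (auto simp: multipartitions_def)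
  then obtain q where q: "is_partition q"
      "\<And>i. component_count e (s ! 0) q i = component_count e (s ! 0) (M ! 0) i + k"
    using ex_add_hooks[OF e, of "M ! 0" "s ! 0" k] by blast
  define M' where "M' = M[0 := q]"
  have "M' \<in> multipartitions (length s)"
    using M(1) q(1) set_update_subset_insert[of M 0 q] by (auto simp: multipartitions_def M'_def)
  moreover have "residue_count e s M' i = residue_count e s M i + k" for i
  proof -
    have "(\<Sum>j\<in>{..<length M} - {0}. component_count e (s ! j) (M' ! j) i)
        = (\<Sum>j\<in>{..<length M} - {0}. component_count e (s ! j) (M ! j) i)"
      by (intro sum.cong) (auto simp: M'_def)
    moreover have "M' ! 0 = q" "length M' = length M" using 0 by (auto simp: M'_def)
    ultimately show ?thesis
      using 0 q(2) by (simp add: residue_count_eq_sum sum.remove[of "{..<length M}" 0])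
  qed
  ultimately show False
    using red shift unfolding reduced_multicore_iff by fastforce
qed

text \<open>
  Minimality is used twice: against the levels of \<open>L\<close> itself it shows that all components are
  \<open>e\<close>-cores, and against all other matrices it makes the levels optimal.
\<close>

lemma weight_reduced_multicore:
  assumes e: "e > 0" and len: "length s = r" "r > 0" and red: "reduced_multicore e s L"
  shows "\<exists>E. E ` {..<r} \<subseteq> Pow {1..e} \<and> weight e s L = of_int (\<Sum>j<r. \<Sum>k<r. set_weight (E j) (E k)) / 2"
proof -
  let ?v = "\<lambda>j. level e (s ! j) (L ! j)"
  have L: "length L = r" "\<And>j. j < r \<Longrightarrow> is_partition (L ! j)"
    using red len by (auto simp: reduced_multicore_def multipartitions_def)
  have s: "s \<noteq> []" using len by auto
  note minimal = reduced_multicore_minimal[OF e s red, unfolded len]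
  have lower: "(\<Sum>j<r. \<Sum>i<e. ?v j i * (?v j i - 1)) \<le> 2 * int (residue_count e s L 0)"
    unfolding residue_count_eq_sum L(1) of_nat_sum sum_distrib_left
    by (intro sum_mono energy_le_count[OF e] L(2)) simp
  have energy: "2 * int (residue_count e s L 0) = (\<Sum>j<r. \<Sum>i<e. ?v j i * (?v j i - 1))"
    using lower minimal[of ?v] by (simp add: sum_level[OF e])
  obtain a b E where E: "\<forall>j<r. \<forall>i<e. ?v j i = a j + b i + of_bool (i \<in> E j)"
  proof -
    have "\<exists>a b E. \<forall>j<r. \<forall>i<e. ?v j i = a j + b i + of_bool (i \<in> E j)"
      by (rule optimal_transport_levels[OF e])
         (use minimal in \<open>simp add: energy[symmetric] sum_level[OF e]\<close>)
    then show ?thesis using that by blast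
  qed
  \<comment> \<open>Runners are numbered from 0, elements of the subsets from 1.\<close>
  define E' where "E' j = Suc ` (E j \<inter> {..<e})" for j
  have E': "E' j \<subseteq> {1..e}" for j by (auto simp: E'_def)
  have "?v j i = a j + b i + of_bool (Suc i \<in> E' j)" if "j < r" "i < e" for j i
    using E that by (auto simp: E'_def)
  from weight_of_two_valued_levels[OF e len(1) L(1) E' this energy] E' show ?thesis by blast
qed

text \<open>
  Levels in \<open>{0, 1}\<close> have energy 0, so residue 0 does not occur and the null root cannot be
  subtracted from the content.
\<close>

lemma ex_reduced_multicore:
  assumes e: "e > 0" and E: "E ` {..<r} \<subseteq> Pow {1..e}"
  shows "\<exists>s L. length s = r \<and> reduced_multicore e s L \<and>
    weight e s L = of_int (\<Sum>j<r. \<Sum>k<r. set_weight (E j) (E k)) / 2"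
proof -
  define s where "s = map (\<lambda>j. int (card (E j))) [0..<r]"
  \<comment> \<open>The full set has charge congruent to 0, so its levels are lowered to 0 to have the right sum.\<close>
  define a where "a j = (if E j = {1..e} then - 1 else 0 :: int)" for j
  define v where "v j i = a j + 0 + of_bool (Suc i \<in> E j)" for j i
  have s: "length s = r" "\<And>j. j < r \<Longrightarrow> s ! j = int (card (E j))" by (simp_all add: s_def)
  have E': "E j \<subseteq> {1..e}" if "j < r" for j using E that by auto
  have "(\<Sum>i<e. v j i) = s ! j mod int e" if "j < length s" for j
  proof -
    have "(\<Sum>i<e. v j i) = int e * a j + int (card (E j))"
      using sum_of_bool_Suc_mem[OF E'] that by (simp add: v_def sum.distrib s(1) del: sum_of_bool_eq)
    moreover have "card (E j) < e" if "E j \<noteq> {1..e}"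
      using psubset_card_mono[of "{1..e}" "E j"] that E'[of j] \<open>j < length s\<close> by (auto simp: s(1))
    ultimately show ?thesis using that s by (auto simp: a_def)
  qed
  then obtain L where L: "L \<in> multipartitions r"
      "\<And>j i. j < r \<Longrightarrow> i < e \<Longrightarrow> level e (s ! j) (L ! j) i = v j i"
      "2 * int (residue_count e s L 0) = (\<Sum>j<r. \<Sum>i<e. v j i * (v j i - 1))"
    using ex_multipartition_levels[OF e, of s v] s(1) by auto
  have "(\<Sum>j<r. \<Sum>i<e. v j i * (v j i - 1)) = 0"
    by (intro sum.neutral ballI) (simp add: v_def a_def)
  then have "residue_count e s L 0 = 0" using L(3) by simp
  then have "reduced_multicore e s L"
    using L(1) s(1) e unfolding reduced_multicore_iff by force
  moreover have "weight e s L = of_int (\<Sum>j<r. \<Sum>k<r. set_weight (E j) (E k)) / 2"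
  proof (rule weight_of_two_valued_levels[OF e s(1)])
    show "length L = r" using L(1) by (simp add: multipartitions_def)
    show "2 * int (residue_count e s L 0) =
      (\<Sum>j<r. \<Sum>i<e. level e (s ! j) (L ! j) i * (level e (s ! j) (L ! j) i - 1))"
      using L(2,3) by simp
    show "level e (s ! j) (L ! j) i = a j + 0 + of_bool (Suc i \<in> E j)" if "j < r" "i < e" for j i
      using L(2)[OF that] by (simp add: v_def)
  qed (use E' in auto)
  ultimately show ?thesis using s(1) by blast
qed

section \<open>Maximal weight of a reduced multicore\<close>

lemma Sup_ereal_finite:
  assumes "finite A" "A \<noteq> {}"
  shows "Sup (ereal ` A) = ereal (Max A)"
  using assms by (intro Sup_eqI) auto

theorem proposition3p17:
  fixes r e :: nat
  assumes "r \<ge> 2" and "e \<ge> 2"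
  shows "(\<forall>x \<in> nat_vectors e. quad_form e x \<in> \<nat>) \<and>
         max_weight r e = ereal (Max {quad_form e x | x. x \<in> nat_vectors e \<and> norm_one e x = real r})"
proof
  show "\<forall>x\<in>nat_vectors e. quad_form e x \<in> \<nat>" by (blast intro: quad_form_Nats)
  have pos: "e > 0" "r > 0" using assms by simp_all
  let ?Q = "{quad_form e x | x. x \<in> nat_vectors e \<and> norm_one e x = real r}"
  let ?W = "{weight e s L | s L. length s = r \<and> reduced_multicore e s L}"
  have Q: "?Q = quad_form e ` {x \<in> nat_vectors e. norm_one e x = real r}" by blast
  have fin: "finite ?Q" "?Q \<noteq> {}"
    unfolding Q using finite_nat_vectors_norm_one nat_vectors_norm_one_nonempty by auto
  have W: "?W = ?Q"
  proof (intro equalityI subsetI)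
    fix w assume "w \<in> ?W"
    then obtain s L where sL: "length s = r" "reduced_multicore e s L" "w = weight e s L" by blast
    obtain E where E: "E ` {..<r} \<subseteq> Pow {1..e}"
        "w = of_int (\<Sum>j<r. \<Sum>k<r. set_weight (E j) (E k)) / 2"
      using weight_reduced_multicore[OF pos(1) sL(1) pos(2) sL(2)] sL(3) by blast
    obtain x where "x \<in> nat_vectors e" "norm_one e x = real r" "quad_form e x = w"
      using ex_vector_of_family[OF E(1)] unfolding E(2) by blast
    then show "w \<in> ?Q" by blast
  next
    fix q assume "q \<in> ?Q"
    then obtain x where x: "x \<in> nat_vectors e" "norm_one e x = real r" "q = quad_form e x" by blast
    obtain E where E: "E ` {..<r} \<subseteq> Pow {1..e}"
        "q = of_int (\<Sum>j<r. \<Sum>k<r. set_weight (E j) (E k)) / 2"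
      using ex_family_of_vector[OF x(1,2)] unfolding x(3) by blast
    obtain s L where "length s = r" "reduced_multicore e s L" "weight e s L = q"
      using ex_reduced_multicore[OF pos(1) E(1)] unfolding E(2) by blast
    then show "q \<in> ?W" by blast
  qed
  have "max_weight r e = Sup (ereal ` ?W)"
    unfolding max_weight_def by (rule arg_cong[where f = Sup]) blast
  then show "max_weight r e = ereal (Max ?Q)"
    unfolding W Sup_ereal_finite[OF fin] .
qed

end
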